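(* Let $A$ and $B$ be finite-dimensional $C^*$-algebras. Let $\varphi\colon A\to B$ be a linear map that is completely positive and completely contractive. Let $\delta\in A\otimes A^{op}$ be the diagonal projection of $A$. Then $\varphi$ is a homomorphism if and only if $(\varphi\otimes\mathrm{id})(\delta)\in B\otimes A^{op}$ is a projection.
   Context: $C^*$-algebras are assumed nonzero. $A^{op}$ is the $C^*$-algebra with the same underlying vector space as $A$ and with the reversed multiplication. The diagonal projection $\delta$ of $A$ is the maximum projection in $A\otimes A^{op}$ that is orthogonal to $p\otimes(1-p)$ for all projections $p\in A$. "Homomorphism" means $*$-homomorphism (not necessarily unital); since completely positive maps are $*$-preserving, this amounts to multiplicativity. "Projection" means self-adjoint idempotent. "Completely contractive" means that $\varphi\otimes\mathrm{id}_{M_r(\mathbb{C})}$ has norm at most $1$ for every positive integer $r$. Here $\mathrm{id}$ is the identity map on $A^{op}$. *)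

theory Defs
  imports Complex_Main "HOL-Library.Poly_Mapping" "Jordan_Normal_Form.Matrix"
begin

section \<open>Complex *-algebras and C*-algebras\<close>

class complex_vector = ab_group_add +
  fixes scaleC :: "complex \<Rightarrow> 'a \<Rightarrow> 'a"  (infixr \<open>*\<^sub>C\<close> 75)
  assumes scaleC_add_right: "c *\<^sub>C (x + y) = c *\<^sub>C x + c *\<^sub>C y"
    and scaleC_add_left: "(c + d) *\<^sub>C x = c *\<^sub>C x + d *\<^sub>C x"
    and scaleC_scaleC: "c *\<^sub>C d *\<^sub>C x = (c * d) *\<^sub>C x"
    and scaleC_one: "1 *\<^sub>C x = x"

lemma vector_space_scaleC: "vector_space (scaleC :: complex \<Rightarrow> 'a \<Rightarrow> 'a::complex_vector)"
  by unfold_locales (simp_all add: scaleC_add_right scaleC_add_left scaleC_scaleC scaleC_one)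

lemma scaleC_zero_right: "c *\<^sub>C (0::'a::complex_vector) = 0"
  using scaleC_add_right[of c 0 "0::'a"] by simp

abbreviation clinear :: "('a::complex_vector \<Rightarrow> 'b::complex_vector) \<Rightarrow> bool"
  where "clinear \<equiv> Vector_Spaces.linear scaleC scaleC"

class star_algebra = complex_vector + ring_1 +
  fixes star :: "'a \<Rightarrow> 'a"
  assumes mult_scaleC_left: "c *\<^sub>C x * y = c *\<^sub>C (x * y)"
    and mult_scaleC_right: "x * c *\<^sub>C y = c *\<^sub>C (x * y)"
    and star_star: "star (star x) = x"
    and star_add: "star (x + y) = star x + star y"
    and star_scaleC: "star (c *\<^sub>C x) = cnj c *\<^sub>C star x"
    and star_mult: "star (x * y) = star y * star x"

text \<open>Finite-dimensional C*-algebras are automatically unital, so the unit is part of the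
  structure. In a nonzero unital C*-algebra the unit has norm \<open>1\<close>, so the axiom \<open>norm 1 = 1\<close> of
  \<^class>\<open>real_normed_algebra_1\<close> says precisely that the algebra is nonzero.\<close>

class cstar_algebra = star_algebra + real_normed_algebra_1 + banach +
  assumes scaleR_scaleC: "r *\<^sub>R x = complex_of_real r *\<^sub>C x"
    and norm_scaleC: "norm (c *\<^sub>C x) = cmod c * norm x"
    and norm_star_mult: "norm (star x * x) = (norm x)\<^sup>2"

class fd_cstar_algebra = cstar_algebra +
  assumes finite_dimensional: "\<exists>S. finite S \<and> (\<forall>x. \<exists>f. x = (\<Sum>v\<in>S. f v *\<^sub>C v))"

text \<open>Homomorphisms are not required to preserve the unit.\<close>

definition star_homomorphism :: "('a::star_algebra \<Rightarrow> 'b::star_algebra) \<Rightarrow> bool"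
  where "star_homomorphism \<phi> \<longleftrightarrow> clinear \<phi> \<and> (\<forall>x y. \<phi> (x * y) = \<phi> x * \<phi> y) \<and>
    (\<forall>x. \<phi> (star x) = star (\<phi> x))"

definition is_projection :: "'a::star_algebra \<Rightarrow> bool"
  where "is_projection p \<longleftrightarrow> star p = p \<and> p * p = p"

text \<open>The usual order and orthogonality relation, applied to projections only.\<close>

definition proj_le :: "'a::star_algebra \<Rightarrow> 'a \<Rightarrow> bool"
  where "proj_le p q \<longleftrightarrow> p * q = p"

definition orthogonal_proj :: "'a::star_algebra \<Rightarrow> 'a \<Rightarrow> bool"
  where "orthogonal_proj p q \<longleftrightarrow> p * q = 0"


section \<open>The opposite algebra\<close>

typedef 'a opposite = "UNIV :: 'a set"
  morphisms unop Op ..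

setup_lifting type_definition_opposite

instantiation opposite :: (complex_vector) complex_vector
begin

lift_definition zero_opposite :: "'a opposite" is 0 .
lift_definition plus_opposite :: "'a opposite \<Rightarrow> 'a opposite \<Rightarrow> 'a opposite" is "(+)" .
lift_definition minus_opposite :: "'a opposite \<Rightarrow> 'a opposite \<Rightarrow> 'a opposite" is "(-)" .
lift_definition uminus_opposite :: "'a opposite \<Rightarrow> 'a opposite" is uminus .
lift_definition scaleC_opposite :: "complex \<Rightarrow> 'a opposite \<Rightarrow> 'a opposite" is scaleC .

instance
  by standard (transfer; simp add: algebra_simps scaleC_add_right scaleC_add_left scaleC_scaleC
      scaleC_one)+

end

instantiation opposite :: (star_algebra) star_algebra
begin

lift_definition one_opposite :: "'a opposite" is 1 .
lift_definition times_opposite :: "'a opposite \<Rightarrow> 'a opposite \<Rightarrow> 'a opposite" is "\<lambda>x y. y * x" .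
lift_definition star_opposite :: "'a opposite \<Rightarrow> 'a opposite" is star .

instance
  by standard (transfer; simp add: algebra_simps mult_scaleC_left mult_scaleC_right star_star
      star_add star_scaleC star_mult)+

end


section \<open>The tensor product\<close>

text \<open>The algebraic tensor product over the complex numbers, as the quotient of the free vector
  space on \<open>'a \<times> 'b\<close> by the bilinearity relations. For finite-dimensional C*-algebras it is already
  complete, and its *-algebra structure is that of the C*-algebraic tensor product.\<close>

definition free_scale :: "complex \<Rightarrow> ('x \<Rightarrow>\<^sub>0 complex) \<Rightarrow> ('x \<Rightarrow>\<^sub>0 complex)"
  where "free_scale c = Poly_Mapping.map ((*) c)"

lemma lookup_free_scale: "Poly_Mapping.lookup (free_scale c x) k = c * Poly_Mapping.lookup x k"
  by (simp add: free_scale_def Poly_Mapping.map.rep_eq when_def)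

lemma vector_space_free: "vector_space free_scale"
  by unfold_locales
    (auto intro!: poly_mapping_eqI simp: lookup_free_scale lookup_add algebra_simps)

interpretation free: vector_space free_scale
  by (rule vector_space_free)

abbreviation pure :: "'a \<Rightarrow> 'b \<Rightarrow> ('a \<times> 'b \<Rightarrow>\<^sub>0 complex)"
  where "pure a b \<equiv> Poly_Mapping.single (a, b) 1"

definition tensor_relations :: "('a::complex_vector \<times> 'b::complex_vector \<Rightarrow>\<^sub>0 complex) set"
  where "tensor_relations =
    {pure (a + a') b - pure a b - pure a' b | a a' b. True} \<union>
    {pure a (b + b') - pure a b - pure a b' | a b b'. True} \<union>
    {pure (c *\<^sub>C a) b - free_scale c (pure a b) | c a b. True} \<union>
    {pure a (c *\<^sub>C b) - free_scale c (pure a b) | c a b. True}"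

definition tensor_null :: "('a::complex_vector \<times> 'b::complex_vector \<Rightarrow>\<^sub>0 complex) set"
  where "tensor_null = module.span free_scale tensor_relations"

lemma tensor_null_0: "0 \<in> tensor_null"
  and tensor_null_add: "x \<in> tensor_null \<Longrightarrow> y \<in> tensor_null \<Longrightarrow> x + y \<in> tensor_null"
  and tensor_null_diff: "x \<in> tensor_null \<Longrightarrow> y \<in> tensor_null \<Longrightarrow> x - y \<in> tensor_null"
  and tensor_null_neg: "x \<in> tensor_null \<Longrightarrow> - x \<in> tensor_null"
  and tensor_null_scale: "x \<in> tensor_null \<Longrightarrow> free_scale c x \<in> tensor_null"
  and tensor_null_base: "x \<in> tensor_relations \<Longrightarrow> x \<in> tensor_null"
  unfolding tensor_null_def
  by (fact free.span_zero free.span_add free.span_diff free.span_neg free.span_scale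
      free.span_base)+

definition tensor_rel ::
  "('a::complex_vector \<times> 'b::complex_vector \<Rightarrow>\<^sub>0 complex) \<Rightarrow> ('a \<times> 'b \<Rightarrow>\<^sub>0 complex) \<Rightarrow> bool"
  where "tensor_rel x y \<longleftrightarrow> x - y \<in> tensor_null"

quotient_type (overloaded) ('a, 'b) tensor =
  "('a::complex_vector \<times> 'b::complex_vector) \<Rightarrow>\<^sub>0 complex" / tensor_rel
proof (rule equivpI)
  show "reflp tensor_rel"
    by (simp add: reflp_def tensor_rel_def tensor_null_0)
  show "symp tensor_rel"
    unfolding symp_def tensor_rel_def by (metis minus_diff_eq tensor_null_neg)
  show "transp tensor_rel"
    unfolding transp_def tensor_rel_def
  proof (intro allI impI)
    fix x y z
    assume "x - y \<in> tensor_null" "y - z \<in> tensor_null"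
    from tensor_null_add[OF this] show "x - z \<in> tensor_null" by simp
  qed
qed

instantiation tensor :: (complex_vector, complex_vector) complex_vector
begin

lift_definition zero_tensor :: "('a, 'b) tensor" is 0 .

lift_definition plus_tensor :: "('a, 'b) tensor \<Rightarrow> ('a, 'b) tensor \<Rightarrow> ('a, 'b) tensor" is "(+)"
  unfolding tensor_rel_def by (metis add_diff_add tensor_null_add)

lift_definition minus_tensor :: "('a, 'b) tensor \<Rightarrow> ('a, 'b) tensor \<Rightarrow> ('a, 'b) tensor" is "(-)"
proof -
  fix x x' y y' :: "('a \<times> 'b) \<Rightarrow>\<^sub>0 complex"
  assume "tensor_rel x x'" "tensor_rel y y'"
  then have "(x - x') - (y - y') \<in> tensor_null"
    unfolding tensor_rel_def by (rule tensor_null_diff)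
  then show "tensor_rel (x - y) (x' - y')"
    unfolding tensor_rel_def by (simp add: algebra_simps)
qed

lift_definition uminus_tensor :: "('a, 'b) tensor \<Rightarrow> ('a, 'b) tensor" is uminus
proof -
  fix x x' :: "('a \<times> 'b) \<Rightarrow>\<^sub>0 complex"
  assume "tensor_rel x x'"
  then have "- (x - x') \<in> tensor_null"
    unfolding tensor_rel_def by (rule tensor_null_neg)
  then show "tensor_rel (- x) (- x')"
    unfolding tensor_rel_def by (simp add: algebra_simps)
qed

lift_definition scaleC_tensor :: "complex \<Rightarrow> ('a, 'b) tensor \<Rightarrow> ('a, 'b) tensor" is free_scale
  unfolding tensor_rel_def by (metis free.scale_right_diff_distrib tensor_null_scale)

instance
proof
  fix x y z :: "('a, 'b) tensor" and c d :: complex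
  have eq: "u = v \<Longrightarrow> tensor_rel u v" for u v :: "('a \<times> 'b) \<Rightarrow>\<^sub>0 complex"
    by (simp add: tensor_rel_def tensor_null_0)
  show "x + y + z = x + (y + z)" by transfer (rule eq, rule add.assoc)
  show "x + y = y + x" by transfer (rule eq, rule add.commute)
  show "0 + x = x" by transfer (rule eq, simp)
  show "- x + x = 0" by transfer (rule eq, simp)
  show "x - y = x + - y" by transfer (rule eq, simp)
  show "c *\<^sub>C (x + y) = c *\<^sub>C x + c *\<^sub>C y" by transfer (rule eq, rule free.scale_right_distrib)
  show "(c + d) *\<^sub>C x = c *\<^sub>C x + d *\<^sub>C x" by transfer (rule eq, rule free.scale_left_distrib)
  show "c *\<^sub>C d *\<^sub>C x = (c * d) *\<^sub>C x" by transfer (rule eq, simp)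
  show "1 *\<^sub>C x = x" by transfer (rule eq, simp)
qed

end

lift_definition tensor_of :: "'a::complex_vector \<Rightarrow> 'b::complex_vector \<Rightarrow> ('a, 'b) tensor"
  (infixr \<open>\<otimes>\<^sub>t\<close> 72) is pure .

lemma tensor_relations_intros:
  "pure (a + a') b - pure a b - pure a' b \<in> tensor_relations"
  "pure a (b + b') - pure a b - pure a b' \<in> tensor_relations"
  "pure (c *\<^sub>C a) b - free_scale c (pure a b) \<in> tensor_relations"
  "pure a (c *\<^sub>C b) - free_scale c (pure a b) \<in> tensor_relations"
  unfolding tensor_relations_def by blast+

lemmas tensor_null_intros = tensor_relations_intros[THEN tensor_null_base]

lemma tensor_add_left: "(a + a') \<otimes>\<^sub>t b = a \<otimes>\<^sub>t b + a' \<otimes>\<^sub>t b"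
  by transfer (simp only: tensor_rel_def diff_diff_eq[symmetric] tensor_null_intros)

lemma tensor_add_right: "a \<otimes>\<^sub>t (b + b') = a \<otimes>\<^sub>t b + a \<otimes>\<^sub>t b'"
  by transfer (simp only: tensor_rel_def diff_diff_eq[symmetric] tensor_null_intros)

lemma tensor_scaleC_left: "(c *\<^sub>C a) \<otimes>\<^sub>t b = c *\<^sub>C (a \<otimes>\<^sub>t b)"
  by transfer (simp only: tensor_rel_def tensor_null_intros)

lemma tensor_scaleC_right: "a \<otimes>\<^sub>t (c *\<^sub>C b) = c *\<^sub>C (a \<otimes>\<^sub>t b)"
  by transfer (simp only: tensor_rel_def tensor_null_intros)

lemma free_induct [case_names zero pure add]:
  assumes "P 0" and "\<And>c a b. P (free_scale c (pure a b))"
    and "\<And>x y. P x \<Longrightarrow> P y \<Longrightarrow> P (x + y)"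
  shows "P (x :: ('a \<times> 'b) \<Rightarrow>\<^sub>0 complex)"
proof (induction x rule: update_induct)
  case const
  show ?case by (rule assms)
next
  case (update x k c)
  obtain a b where k: "k = (a, b)" by force
  have "Poly_Mapping.update k c x = x + free_scale c (pure a b)"
    using update(1) unfolding k
    by (intro poly_mapping_eqI)
      (auto simp: lookup_update lookup_add lookup_free_scale lookup_single in_keys_iff when_def)
  with update assms show ?case by simp
qed

lemma tensor_induct [case_names zero pure add]:
  assumes z: "P 0" and p: "\<And>a b. P (a \<otimes>\<^sub>t b)" and a: "\<And>x y. P x \<Longrightarrow> P y \<Longrightarrow> P (x + y)"
  shows "P x"
proof -
  have "P (abs_tensor u)" for u
  proof (induction u rule: free_induct)
    case zero
    show ?case using z by (simp add: zero_tensor_def)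
  next
    case (pure c a b)
    have "abs_tensor (free_scale c (pure a b)) = (c *\<^sub>C a) \<otimes>\<^sub>t b"
      by (simp only: tensor_scaleC_left) (simp add: tensor_of.abs_eq scaleC_tensor.abs_eq)
    with p show ?case by simp
  next
    case (add u v)
    with a show ?case by (simp add: plus_tensor.abs_eq[symmetric])
  qed
  then show ?thesis by (metis Quotient_abs_rep[OF Quotient_tensor])
qed


subsection \<open>The universal property\<close>

text \<open>The scalar multiplication \<open>s\<close> on the target is a parameter so that conjugate-linear maps
  are covered as well.\<close>

definition free_lift ::
  "(complex \<Rightarrow> 'c \<Rightarrow> 'c) \<Rightarrow> ('a \<Rightarrow> 'b \<Rightarrow> 'c) \<Rightarrow> ('a \<times> 'b \<Rightarrow>\<^sub>0 complex) \<Rightarrow> 'c::ab_group_add"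
  where "free_lift s f x = (\<Sum>(a, b)\<in>Poly_Mapping.keys x. s (Poly_Mapping.lookup x (a, b)) (f a b))"

definition tensor_lift ::
  "(complex \<Rightarrow> 'c \<Rightarrow> 'c) \<Rightarrow> ('a \<Rightarrow> 'b \<Rightarrow> 'c) \<Rightarrow> ('a::complex_vector, 'b::complex_vector) tensor
    \<Rightarrow> 'c::ab_group_add"
  where "tensor_lift s f t = free_lift s f (rep_tensor t)"

definition bilinear_by ::
  "(complex \<Rightarrow> 'c \<Rightarrow> 'c) \<Rightarrow> ('a::complex_vector \<Rightarrow> 'b::complex_vector \<Rightarrow> 'c::ab_group_add) \<Rightarrow> bool"
  where "bilinear_by s f \<longleftrightarrow>
    (\<forall>a a' b. f (a + a') b = f a b + f a' b) \<and> (\<forall>a b b'. f a (b + b') = f a b + f a b') \<and>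
    (\<forall>c a b. f (c *\<^sub>C a) b = s c (f a b)) \<and> (\<forall>c a b. f a (c *\<^sub>C b) = s c (f a b))"

context
  fixes s :: "complex \<Rightarrow> 'c \<Rightarrow> 'c::ab_group_add"
  assumes s: "vector_space s"
begin

interpretation s: vector_space s by (rule s)

lemma free_lift_superset:
  assumes "finite K" "Poly_Mapping.keys x \<subseteq> K"
  shows "free_lift s f x = (\<Sum>(a, b)\<in>K. s (Poly_Mapping.lookup x (a, b)) (f a b))"
  unfolding free_lift_def
  by (rule sum.mono_neutral_left) (use assms in \<open>auto simp: in_keys_iff\<close>)

lemma free_lift_add: "free_lift s f (x + y) = free_lift s f x + free_lift s f y"
proof -
  let ?K = "Poly_Mapping.keys x \<union> Poly_Mapping.keys y"
  have K: "finite ?K" "Poly_Mapping.keys (x + y) \<subseteq> ?K" "Poly_Mapping.keys x \<subseteq> ?K"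
    "Poly_Mapping.keys y \<subseteq> ?K"
    using keys_add[of x y] by auto
  show ?thesis
    by (simp add: free_lift_superset[OF K(1,2)] free_lift_superset[OF K(1,3)]
        free_lift_superset[OF K(1,4)] case_prod_beta lookup_add s.scale_left_distrib sum.distrib)
qed

lemma free_lift_scale: "free_lift s f (free_scale c x) = s c (free_lift s f x)"
proof -
  have K: "Poly_Mapping.keys (free_scale c x) \<subseteq> Poly_Mapping.keys x"
    by (auto simp: in_keys_iff lookup_free_scale)
  show ?thesis
    unfolding free_lift_superset[OF finite_keys K] free_lift_def[of s f x]
    by (simp add: case_prod_beta lookup_free_scale s.scale_sum_right)
qed

lemma free_lift_diff: "free_lift s f (x - y) = free_lift s f x - free_lift s f y"
  using free_lift_add[of f "x - y" y] by simp

lemma free_lift_pure: "free_lift s f (pure a b) = f a b"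
  by (simp add: free_lift_def)

lemma free_lift_null:
  assumes f: "bilinear_by s f" and x: "x \<in> tensor_null"
  shows "free_lift s f x = 0"
  using x unfolding tensor_null_def
proof (induction x rule: free.span_induct_alt)
  case base
  show ?case by (simp add: free_lift_def)
next
  case (step c x y)
  have "free_lift s f x = 0"
    using step(1) f unfolding tensor_relations_def bilinear_by_def
    by (auto simp: free_lift_diff free_lift_pure free_lift_scale)
  with step show ?case by (simp add: free_lift_add free_lift_scale)
qed

lemma tensor_lift_abs:
  assumes "bilinear_by s f"
  shows "tensor_lift s f (abs_tensor x) = free_lift s f x"
proof -
  have "tensor_rel (rep_tensor (abs_tensor x)) x"
    by (metis Quotient_tensor Quotient_rep_abs tensor.abs_eq_iff Quotient_abs_rep)
  then have "free_lift s f (rep_tensor (abs_tensor x) - x) = 0"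
    unfolding tensor_rel_def by (rule free_lift_null[OF assms])
  then show ?thesis by (simp add: tensor_lift_def free_lift_diff)
qed

lemma tensor_lift_pure:
  assumes "bilinear_by s f"
  shows "tensor_lift s f (a \<otimes>\<^sub>t b) = f a b"
  by (simp add: tensor_of.abs_eq tensor_lift_abs[OF assms] free_lift_pure)

lemma tensor_lift_add:
  assumes "bilinear_by s f"
  shows "tensor_lift s f (x + y) = tensor_lift s f x + tensor_lift s f y"
  by (induction x rule: tensor.abs_induct, induction y rule: tensor.abs_induct)
    (simp add: plus_tensor.abs_eq tensor_lift_abs[OF assms] free_lift_add)

lemma tensor_lift_scaleC:
  assumes "bilinear_by s f"
  shows "tensor_lift s f (c *\<^sub>C x) = s c (tensor_lift s f x)"
  by (induction x rule: tensor.abs_induct)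
    (simp add: scaleC_tensor.abs_eq tensor_lift_abs[OF assms] free_lift_scale)

lemma tensor_lift_0:
  assumes "bilinear_by s f"
  shows "tensor_lift s f 0 = 0"
  using tensor_lift_add[OF assms, of 0 0] by simp

end


lemma ex_functional:
  assumes "v \<noteq> (0::'a::complex_vector)"
  shows "\<exists>g. Vector_Spaces.linear scaleC (*) g \<and> g v = (1::complex)"
proof -
  interpret vector_space_pair "scaleC :: complex \<Rightarrow> 'a \<Rightarrow> 'a" "(*) :: complex \<Rightarrow> complex \<Rightarrow> complex"
    by unfold_locales (simp_all add: scaleC_add_right scaleC_add_left scaleC_scaleC scaleC_one
        algebra_simps)
  have "\<not> vs1.dependent {v}"
    using assms by simp
  from linear_independent_extend[OF this, of "\<lambda>_. 1"] show ?thesis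
    by auto
qed

lemma tensor_of_nonzero:
  assumes "a \<noteq> 0" "b \<noteq> 0"
  shows "a \<otimes>\<^sub>t b \<noteq> 0"
proof
  assume zero: "a \<otimes>\<^sub>t b = 0"
  obtain g h where g: "Vector_Spaces.linear scaleC (*) g" "g a = (1::complex)"
    and h: "Vector_Spaces.linear scaleC (*) h" "h b = (1::complex)"
    using ex_functional assms by metis
  have vs: "vector_space ((*) :: complex \<Rightarrow> complex \<Rightarrow> complex)"
    by unfold_locales (simp_all add: algebra_simps)
  interpret g: Vector_Spaces.linear scaleC "(*)" g by (rule g)
  interpret h: Vector_Spaces.linear scaleC "(*)" h by (rule h)
  have bil: "bilinear_by (*) (\<lambda>a b. g a * h b)"
    unfolding bilinear_by_def g.add h.add g.scale h.scale
    by (simp only: distrib_left distrib_right mult.assoc mult.left_commute simp_thms)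
  have "tensor_lift (*) (\<lambda>a b. g a * h b) (a \<otimes>\<^sub>t b) = 1"
    by (simp add: tensor_lift_pure[OF vs bil] g(2) h(2))
  with zero show False
    by (simp add: tensor_lift_0[OF vs bil])
qed


subsection \<open>The *-algebra structure\<close>

instantiation tensor :: (star_algebra, star_algebra) star_algebra
begin

definition one_tensor :: "('a, 'b) tensor"
  where "1 = 1 \<otimes>\<^sub>t 1"

text \<open>\<open>(a \<otimes> b) (c \<otimes> d) = a c \<otimes> b d\<close>, extended bilinearly\<close>

definition times_tensor :: "('a, 'b) tensor \<Rightarrow> ('a, 'b) tensor \<Rightarrow> ('a, 'b) tensor"
  where "x * y =
    tensor_lift scaleC (\<lambda>a b. tensor_lift scaleC (\<lambda>c d. (a * c) \<otimes>\<^sub>t (b * d)) y) x"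

text \<open>\<open>(a \<otimes> b)* = a* \<otimes> b*\<close>, extended conjugate-linearly\<close>

definition star_tensor :: "('a, 'b) tensor \<Rightarrow> ('a, 'b) tensor"
  where "star x = tensor_lift (\<lambda>c. scaleC (cnj c)) (\<lambda>a b. star a \<otimes>\<^sub>t star b) x"

context
begin

private lemma bil_inner:
  "bilinear_by scaleC (\<lambda>c d. ((a::'a) * c) \<otimes>\<^sub>t ((b::'b) * d))"
  by (simp add: bilinear_by_def distrib_left mult_scaleC_right tensor_add_left tensor_add_right
      tensor_scaleC_left tensor_scaleC_right)

private lemmas inner_simps =
  tensor_lift_pure[OF vector_space_scaleC bil_inner] tensor_lift_add[OF vector_space_scaleC bil_inner]
  tensor_lift_scaleC[OF vector_space_scaleC bil_inner] tensor_lift_0[OF vector_space_scaleC bil_inner]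

private lemma bil_outer:
  "bilinear_by scaleC (\<lambda>(a::'a) (b::'b). tensor_lift scaleC (\<lambda>c d. (a * c) \<otimes>\<^sub>t (b * d)) y)"
proof (induction y rule: tensor_induct)
  case zero
  show ?case
    by (simp add: bilinear_by_def inner_simps scaleC_zero_right)
next
  case (pure a b)
  show ?case
    by (simp add: bilinear_by_def inner_simps distrib_right mult_scaleC_left tensor_add_left
        tensor_add_right tensor_scaleC_left tensor_scaleC_right)
next
  case (add x y)
  then show ?case
    by (simp add: bilinear_by_def inner_simps scaleC_add_right)
qed

private lemma bil_star:
  "bilinear_by (\<lambda>c. scaleC (cnj c)) (\<lambda>(a::'a) (b::'b). star a \<otimes>\<^sub>t star b)"
  by (simp add: bilinear_by_def star_add star_scaleC tensor_add_left tensor_add_right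
      tensor_scaleC_left tensor_scaleC_right)

private lemma vs_cnj:
  "vector_space (\<lambda>c. scaleC (cnj c) :: ('a, 'b) tensor \<Rightarrow> ('a, 'b) tensor)"
  by unfold_locales (simp_all add: scaleC_add_right scaleC_add_left scaleC_scaleC scaleC_one)

private lemma pure_mult:
  "(a \<otimes>\<^sub>t b) * y = tensor_lift scaleC (\<lambda>c d. ((a::'a) * c) \<otimes>\<^sub>t ((b::'b) * d)) y"
  by (simp only: times_tensor_def tensor_lift_pure[OF vector_space_scaleC bil_outer])

lemma tensor_mult_pure:
  "(a \<otimes>\<^sub>t b) * (c \<otimes>\<^sub>t d) = ((a::'a) * c) \<otimes>\<^sub>t ((b::'b) * d)"
  by (simp only: pure_mult inner_simps)

lemma tensor_star_pure: "star (a \<otimes>\<^sub>t b) = star (a::'a) \<otimes>\<^sub>t star (b::'b)"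
  by (simp add: star_tensor_def tensor_lift_pure[OF vs_cnj bil_star])

private lemma add_mult: "(x + y) * z = x * z + y * (z :: ('a, 'b) tensor)"
  by (simp add: times_tensor_def tensor_lift_add[OF vector_space_scaleC bil_outer])

private lemma scale_mult: "(c *\<^sub>C x) * z = c *\<^sub>C (x * (z :: ('a, 'b) tensor))"
  by (simp add: times_tensor_def tensor_lift_scaleC[OF vector_space_scaleC bil_outer])

private lemma zero_mult: "0 * z = (0 :: ('a, 'b) tensor)"
  by (simp add: times_tensor_def tensor_lift_0[OF vector_space_scaleC bil_outer])

private lemma mult_add: "z * (x + y) = z * x + z * (y :: ('a, 'b) tensor)"
  by (induction z rule: tensor_induct)
    (simp_all add: zero_mult add_mult pure_mult inner_simps)

private lemma mult_scale: "z * (c *\<^sub>C x) = c *\<^sub>C (z * (x :: ('a, 'b) tensor))"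
  by (induction z rule: tensor_induct)
    (simp_all add: zero_mult add_mult scaleC_add_right scaleC_zero_right pure_mult inner_simps)

private lemma mult_zero: "z * 0 = (0 :: ('a, 'b) tensor)"
  using mult_add[of z 0 0] by simp

private lemma tstar_add: "star (x + y) = star x + star (y :: ('a, 'b) tensor)"
  by (simp add: star_tensor_def tensor_lift_add[OF vs_cnj bil_star])

private lemma tstar_scale: "star (c *\<^sub>C x) = cnj c *\<^sub>C star (x :: ('a, 'b) tensor)"
  by (simp add: star_tensor_def tensor_lift_scaleC[OF vs_cnj bil_star])

private lemma tstar_zero: "star 0 = (0 :: ('a, 'b) tensor)"
  using tstar_add[of 0 0] by simp

instance
proof
  fix x y z :: "('a, 'b) tensor" and c :: complex
  show "(x + y) * z = x * z + y * z" by (rule add_mult)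
  show "x * (y + z) = x * y + x * z" by (rule mult_add)
  show "(c *\<^sub>C x) * y = c *\<^sub>C (x * y)" by (rule scale_mult)
  show "x * (c *\<^sub>C y) = c *\<^sub>C (x * y)" by (rule mult_scale)
  show "star (x + y) = star x + star y" by (rule tstar_add)
  show "star (c *\<^sub>C x) = cnj c *\<^sub>C star x" by (rule tstar_scale)
  show "1 * x = x"
    by (induction x rule: tensor_induct)
      (simp_all add: mult_zero mult_add, simp add: one_tensor_def tensor_mult_pure)
  show "x * 1 = x"
    by (induction x rule: tensor_induct)
      (simp_all add: zero_mult add_mult, simp add: one_tensor_def tensor_mult_pure)
  show "(0 :: ('a, 'b) tensor) \<noteq> 1"
    unfolding one_tensor_def by (rule not_sym, rule tensor_of_nonzero) simp_all
  show "star (star x) = x"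
    by (induction x rule: tensor_induct)
      (simp_all add: tstar_zero tstar_add tensor_star_pure star_star)
  show "x * y * z = x * (y * z)"
  proof (induction x rule: tensor_induct)
    case (pure a b)
    show ?case
    proof (induction y rule: tensor_induct)
      case (pure a' b')
      show ?case
        by (induction z rule: tensor_induct)
          (simp_all add: mult_zero mult_add tensor_mult_pure mult.assoc)
    qed (simp_all add: zero_mult mult_zero add_mult mult_add)
  qed (simp_all add: zero_mult add_mult)
  show "star (x * y) = star y * star x"
  proof (induction x rule: tensor_induct)
    case (pure a b)
    show ?case
      by (induction y rule: tensor_induct)
        (simp_all add: tstar_zero zero_mult mult_zero mult_add add_mult tstar_add tensor_mult_pure
          tensor_star_pure star_mult)
  qed (simp_all add: tstar_zero zero_mult mult_zero mult_add add_mult tstar_add)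
qed

end

end

text \<open>The map \<open>\<phi> \<otimes> \<psi>\<close> for linear \<open>\<phi>\<close> and \<open>\<psi>\<close>\<close>

definition tensor_map ::
  "('a::complex_vector \<Rightarrow> 'c::complex_vector) \<Rightarrow> ('b::complex_vector \<Rightarrow> 'd::complex_vector) \<Rightarrow>
    ('a, 'b) tensor \<Rightarrow> ('c, 'd) tensor"
  where "tensor_map \<phi> \<psi> = tensor_lift scaleC (\<lambda>a b. \<phi> a \<otimes>\<^sub>t \<psi> b)"

lemma
  assumes "clinear \<phi>" "clinear \<psi>"
  shows tensor_map_pure: "tensor_map \<phi> \<psi> (a \<otimes>\<^sub>t b) = \<phi> a \<otimes>\<^sub>t \<psi> b"
    and tensor_map_add: "tensor_map \<phi> \<psi> (x + y) = tensor_map \<phi> \<psi> x + tensor_map \<phi> \<psi> y"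
    and tensor_map_scaleC: "tensor_map \<phi> \<psi> (c *\<^sub>C x) = c *\<^sub>C tensor_map \<phi> \<psi> x"
proof -
  interpret l: Vector_Spaces.linear scaleC scaleC \<phi> by (rule assms)
  interpret r: Vector_Spaces.linear scaleC scaleC \<psi> by (rule assms)
  have b: "bilinear_by scaleC (\<lambda>a b. \<phi> a \<otimes>\<^sub>t \<psi> b)"
    by (simp add: bilinear_by_def l.add r.add l.scale r.scale tensor_add_left tensor_add_right
        tensor_scaleC_left tensor_scaleC_right)
  show "tensor_map \<phi> \<psi> (a \<otimes>\<^sub>t b) = \<phi> a \<otimes>\<^sub>t \<psi> b"
    "tensor_map \<phi> \<psi> (x + y) = tensor_map \<phi> \<psi> x + tensor_map \<phi> \<psi> y"
    "tensor_map \<phi> \<psi> (c *\<^sub>C x) = c *\<^sub>C tensor_map \<phi> \<psi> x"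
    unfolding tensor_map_def
    by (rule tensor_lift_pure tensor_lift_add tensor_lift_scaleC, rule vector_space_scaleC, rule b)+
qed


section \<open>The diagonal projection\<close>

definition orthogonal_to_offdiagonal :: "('a::star_algebra, 'a opposite) tensor \<Rightarrow> bool"
  where "orthogonal_to_offdiagonal d \<longleftrightarrow>
    (\<forall>p::'a. is_projection p \<longrightarrow> orthogonal_proj d (p \<otimes>\<^sub>t Op (1 - p)))"

definition is_diagonal_projection :: "('a::star_algebra, 'a opposite) tensor \<Rightarrow> bool"
  where "is_diagonal_projection d \<longleftrightarrow>
    is_projection d \<and> orthogonal_to_offdiagonal d \<and>
    (\<forall>e. is_projection e \<and> orthogonal_to_offdiagonal e \<longrightarrow> proj_le e d)"


section \<open>Completely positive and completely contractive maps\<close>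

text \<open>\<open>A \<otimes> M\<^sub>n(\<complex>)\<close> is the *-algebra \<open>M\<^sub>n(A)\<close> of matrices over \<open>A\<close>; under this identification
  \<open>\<phi> \<otimes> id\<close> is the entrywise application \<^term>\<open>map_mat \<phi>\<close>.\<close>

definition star_mat :: "'a::star_algebra mat \<Rightarrow> 'a mat"
  where "star_mat X = map_mat star (transpose_mat X)"

definition positive_mat :: "nat \<Rightarrow> 'a::star_algebra mat \<Rightarrow> bool"
  where "positive_mat n X \<longleftrightarrow> (\<exists>Y \<in> carrier_mat n n. X = star_mat Y * Y)"

definition completely_positive :: "('a::star_algebra \<Rightarrow> 'b::star_algebra) \<Rightarrow> bool"
  where "completely_positive \<phi> \<longleftrightarrow> (\<forall>n X. positive_mat n X \<longrightarrow> positive_mat n (map_mat \<phi> X))"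

definition is_cstar_norm_mat :: "nat \<Rightarrow> ('a::star_algebra mat \<Rightarrow> real) \<Rightarrow> bool"
  where "is_cstar_norm_mat n N \<longleftrightarrow>
    (\<forall>X \<in> carrier_mat n n. N X = 0 \<longleftrightarrow> X = 0\<^sub>m n n) \<and>
    (\<forall>X \<in> carrier_mat n n. \<forall>Y \<in> carrier_mat n n. N (X + Y) \<le> N X + N Y) \<and>
    (\<forall>X \<in> carrier_mat n n. \<forall>c. N (map_mat (scaleC c) X) = cmod c * N X) \<and>
    (\<forall>X \<in> carrier_mat n n. \<forall>Y \<in> carrier_mat n n. N (X * Y) \<le> N X * N Y) \<and>
    (\<forall>X \<in> carrier_mat n n. N (star_mat X * X) = (N X)\<^sup>2)"

text \<open>If \<open>A\<close> is a C*-algebra, then \<open>M\<^sub>n(A)\<close> has exactly one C*-norm; \<^term>\<open>cstar_norm_mat n X\<close> is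
  the value of that norm at \<open>X\<close>.\<close>

definition cstar_norm_mat :: "nat \<Rightarrow> 'a::cstar_algebra mat \<Rightarrow> real"
  where "cstar_norm_mat n X = (THE r. \<exists>N. is_cstar_norm_mat n N \<and> r = N X)"

definition completely_contractive :: "('a::cstar_algebra \<Rightarrow> 'b::cstar_algebra) \<Rightarrow> bool"
  where "completely_contractive \<phi> \<longleftrightarrow>
    (\<forall>n>0. \<forall>X \<in> carrier_mat n n. cstar_norm_mat n (map_mat \<phi> X) \<le> cstar_norm_mat n X)"

end

theory Submission
  imports Defs "HOL-Computational_Algebra.Fundamental_Theorem_Algebra"
begin

text \<open>Let \<open>\<tau> a\<close> be the trace of the operator \<open>x \<mapsto> a x\<close> on \<open>A\<close>. It satisfies \<open>\<tau> (a b) = \<tau> (b a)\<close>, and by the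
  spectral decomposition of self-adjoint elements it is positive and faithful. So \<open>A\<close> has an
  orthonormal basis \<open>S\<close> for the inner product \<open>\<tau> (star x * y)\<close>. The basis satisfies
  \<open>\<Sum>b\<in>S. b * star b = 1\<close>, and the diagonal projection turns out to be the Casimir element
  \<open>\<delta> = (\<Sum>b\<in>S. b \<otimes> Op (star b))\<close> (theorem \<open>diagonal_projection_eq_casimir\<close>).

  If \<open>\<phi>\<close> is a homomorphism, then so is \<open>\<phi> \<otimes> id\<close>, and the image of a projection is a projection.

  Conversely, let \<open>P = (\<phi> \<otimes> id) \<delta>\<close> be a projection. Computing \<open>P\<close> once as \<open>(\<phi> \<otimes> id) (star \<delta> * \<delta>)\<close> and once
  as \<open>star P * P\<close>, and slicing the result by \<open>id \<otimes> \<tau>\<close>, leads to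
  \<open>(\<Sum>b\<in>S. \<phi> (star b * b) - star (\<phi> b) * \<phi> b) = 0\<close> (theorem \<open>schwarz_defects_sum_to_zero\<close>). Each
  summand is positive by the Kadison--Schwarz inequality, hence zero, and equality in that
  inequality puts \<open>b\<close> into the multiplicative domain of \<open>\<phi>\<close> (lemma \<open>schwarz_defect\<close>). The elements \<open>b\<close>
  span \<open>A\<close>, so \<open>\<phi>\<close> is multiplicative. The Kadison--Schwarz inequality follows from positivity of
  \<open>\<phi>\<close> on three-by-three matrices together with \<open>\<phi> 1 \<le> 1\<close>. The latter is contractivity at the unit
  and uses that the C*-norm on one-by-one matrices is the norm of the algebra
  (theorem \<open>cstar_norm_unique\<close>).\<close>

section \<open>Adjoints and finite bases\<close>

interpretation cvec: vector_space "scaleC :: complex \<Rightarrow> 'a \<Rightarrow> 'a::complex_vector"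
  by (rule vector_space_scaleC)

lemma star_zero [simp]: "star (0::'a::star_algebra) = 0"
  using star_add[of "0::'a" 0] by simp

lemma star_minus: "star (- x) = - star (x::'a::star_algebra)"
  using star_add[of x "- x"] by (simp add: eq_neg_iff_add_eq_0 add.commute)

lemma star_diff: "star (x - y) = star x - star (y::'a::star_algebra)"
  using star_add[of x "- y"] by (simp add: star_minus)

lemma star_one [simp]: "star (1::'a::star_algebra) = 1"
  by (metis mult.right_neutral star_mult star_star)

lemma star_sum: "star (\<Sum>i\<in>I. f i) = (\<Sum>i\<in>I. star (f i :: 'a::star_algebra))"
  by (induction I rule: infinite_finite_induct) (simp_all add: star_add)

lemma star_mult_self_eq_0: "star x * x = 0 \<longleftrightarrow> x = (0::'a::cstar_algebra)"
  using norm_star_mult[of x] by auto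

lemma ex_finite_basis:
  "\<exists>B :: 'a::fd_cstar_algebra set. finite B \<and> cvec.independent B \<and> cvec.span B = UNIV"
proof -
  obtain S :: "'a set" where S: "finite S" "\<And>x. \<exists>f. x = (\<Sum>v\<in>S. f v *\<^sub>C v)"
    using finite_dimensional by blast
  have span: "cvec.span S = UNIV"
  proof -
    have "x \<in> cvec.span S" for x
      using S(2)[of x] by (auto intro: cvec.span_sum cvec.span_scale cvec.span_base)
    then show ?thesis by auto
  qed
  obtain B where B: "B \<subseteq> S" "cvec.independent B" "S \<subseteq> cvec.span B"
    using cvec.maximal_independent_subset[of S] by blast
  have "cvec.span S \<subseteq> cvec.span B"
    by (rule cvec.span_minimal[OF B(3) cvec.subspace_span])
  with span have "cvec.span B = UNIV" by blast
  with B(2) finite_subset[OF B(1) S(1)] show ?thesis by blast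
qed

definition some_basis :: "'a::fd_cstar_algebra set"
  where "some_basis = (SOME B. finite B \<and> cvec.independent B \<and> cvec.span B = UNIV)"

lemma some_basis:
  "finite (some_basis :: 'a::fd_cstar_algebra set)"
  "cvec.independent (some_basis :: 'a set)" "cvec.span (some_basis :: 'a set) = UNIV"
  using someI_ex[OF ex_finite_basis[where 'a='a], folded some_basis_def] by blast+

section \<open>Spectral decomposition of self-adjoint elements\<close>

definition alg_poly :: "'a::star_algebra \<Rightarrow> complex poly \<Rightarrow> 'a"
  where "alg_poly h p = fold_coeffs (\<lambda>c x. c *\<^sub>C 1 + h * x) p 0"

lemma alg_poly_0 [simp]: "alg_poly h 0 = 0"
  by (simp add: alg_poly_def)

lemma alg_poly_pCons [simp]: "alg_poly h (pCons c p) = c *\<^sub>C 1 + h * alg_poly h p"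
  by (cases "p = 0 \<and> c = 0") (auto simp: alg_poly_def)

lemma alg_poly_add: "alg_poly h (p + q) = alg_poly h p + alg_poly h q"
  by (induction p q rule: poly_induct2) (simp_all add: algebra_simps scaleC_add_left)

lemma alg_poly_smult: "alg_poly h (smult c p) = c *\<^sub>C alg_poly h p"
  by (induction p) (simp_all add: scaleC_add_right scaleC_scaleC mult_scaleC_right)

lemma alg_poly_minus: "alg_poly h (p - q) = alg_poly h p - alg_poly h q"
  using alg_poly_add[of h "p - q" q] by simp

lemma alg_poly_monom: "alg_poly h (monom c n) = c *\<^sub>C h ^ n"
  by (induction n) (simp_all add: monom_Suc monom_0 mult_scaleC_right)

lemma alg_poly_sum: "alg_poly h (\<Sum>i\<in>I. p i) = (\<Sum>i\<in>I. alg_poly h (p i))"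
  by (induction I rule: infinite_finite_induct) (simp_all add: alg_poly_add)

lemma alg_poly_linear_factor: "alg_poly h ([:- c, 1:] * q) = h * alg_poly h q - c *\<^sub>C alg_poly h q"
  by (simp add: alg_poly_minus alg_poly_smult)

text \<open>Among the powers of \<open>h\<close> there is a linear relation, because the algebra is finite-dimensional.\<close>
lemma ex_annihilating_poly:
  fixes h :: "'a::fd_cstar_algebra"
  shows "\<exists>p. p \<noteq> 0 \<and> alg_poly h p = 0"
proof (cases "inj (\<lambda>i. h ^ i)")
  case False
  then obtain i j where ij: "i \<noteq> j" "h ^ i = h ^ j"
    by (auto simp: inj_def)
  then have "coeff (monom 1 i - monom (1::complex) j) i \<noteq> 0" by simp
  then have "monom 1 i - monom (1::complex) j \<noteq> 0" by fastforce
  moreover have "alg_poly h (monom 1 i - monom 1 j) = 0"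
    by (simp add: alg_poly_minus alg_poly_monom ij)
  ultimately show ?thesis by blast
next
  case True
  have "cvec.dependent (range (\<lambda>i. h ^ i))"
    using cvec.independent_span_bound[OF some_basis(1), of "range (\<lambda>i. h ^ i)"] some_basis(3) True
    by (auto dest: finite_imageD)
  then obtain T u where T: "finite T" "T \<subseteq> range (\<lambda>i. h ^ i)" "(\<Sum>v\<in>T. u v *\<^sub>C v) = 0"
    and u: "\<exists>v\<in>T. u v \<noteq> 0"
    unfolding cvec.dependent_explicit by blast
  obtain I where I: "T = (\<lambda>i. h ^ i) ` I" using T(2) by (auto simp: subset_image_iff)
  have inj: "inj_on (\<lambda>i. h ^ i) I" using True by (rule inj_on_subset) simp
  have finI: "finite I" using T(1) I inj finite_imageD by blast
  define p where "p = (\<Sum>i\<in>I. monom (u (h ^ i)) i)"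
  obtain i where i: "i \<in> I" "u (h ^ i) \<noteq> 0" using u I by auto
  have "coeff p i = u (h ^ i)"
    using finI i by (simp add: p_def coeff_sum)
  then have "p \<noteq> 0" using i by auto
  moreover have "alg_poly h p = 0"
    using T(3) by (simp add: p_def alg_poly_sum alg_poly_monom I sum.reindex[OF inj])
  ultimately show ?thesis by blast
qed

text \<open>Sums of eigenvectors of left multiplication by \<open>h\<close>, for real eigenvalues only. The unit turns out
  to be such a sum when \<open>h\<close> is self-adjoint, and its components are the spectral projections.\<close>
definition eigen_sum :: "'a::star_algebra \<Rightarrow> 'a \<Rightarrow> bool"
  where "eigen_sum h y \<longleftrightarrow> (\<exists>R f. finite R \<and> (\<forall>r\<in>R. h * f r = complex_of_real r *\<^sub>C f r) \<and>
    y = (\<Sum>r\<in>R. f r))"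

lemma eigenvector_nonreal:
  fixes h :: "'a::cstar_algebra"
  assumes h: "star h = h" and u: "h * u = c *\<^sub>C u" and c: "cnj c \<noteq> c"
  shows "u = 0"
proof -
  have "cnj c *\<^sub>C (star u * u) = star (h * u) * u"
    by (simp add: u star_scaleC mult_scaleC_left)
  also have "\<dots> = star u * (h * u)" by (simp add: star_mult h mult.assoc)
  also have "\<dots> = c *\<^sub>C (star u * u)" by (simp add: u mult_scaleC_right)
  finally have "star u * u = 0" using c by (simp add: cvec.scale_right_imp_eq)
  then show ?thesis by (simp add: star_mult_self_eq_0)
qed

text \<open>This is the step that removes one linear factor \<open>h - c\<close> from an annihilating polynomial. The
  components of \<open>(h - c) y\<close> for eigenvalues other than \<open>c\<close> can be divided by \<open>h - c\<close>, so that a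
  remainder \<open>u\<close> with \<open>(h - c)\<^sup>2 u = 0\<close> is left. Self-adjointness forces \<open>(h - c) u = 0\<close>, so \<open>c\<close>
  is no multiple root, and \<open>u = 0\<close> unless \<open>c\<close> is real.\<close>
lemma eigen_sum_of_shifted:
  fixes h :: "'a::cstar_algebra"
  assumes h: "star h = h" and y: "eigen_sum h (h * y - c *\<^sub>C y)"
  shows "eigen_sum h y"
proof -
  obtain R f where R: "finite R" and f: "\<And>r. r \<in> R \<Longrightarrow> h * f r = complex_of_real r *\<^sub>C f r"
    and z: "h * y - c *\<^sub>C y = (\<Sum>r\<in>R. f r)"
    using y unfolding eigen_sum_def by blast
  \<comment> \<open>The term \<open>g r\<close> solves \<open>(h - c) g r = f r\<close> whenever this can be solved within the eigenspace.\<close>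
  define g where "g r = (if complex_of_real r = c then 0 else (1 / (complex_of_real r - c)) *\<^sub>C f r)" for r
  define u where "u = y - (\<Sum>r\<in>R. g r)"
  define w where "w = (\<Sum>r\<in>R. if complex_of_real r = c then f r else 0)"
  have g: "h * g r = complex_of_real r *\<^sub>C g r" if "r \<in> R" for r
    using f[OF that] by (simp add: g_def mult_scaleC_right scaleC_scaleC mult.commute)
  have diff: "h * g r - c *\<^sub>C g r = (if complex_of_real r = c then 0 else f r)" if "r \<in> R" for r
    unfolding g[OF that] cvec.scale_left_diff_distrib[symmetric] by (simp add: g_def scaleC_scaleC)
  have "h * (\<Sum>r\<in>R. g r) - c *\<^sub>C (\<Sum>r\<in>R. g r) = (\<Sum>r\<in>R. h * g r - c *\<^sub>C g r)"
    by (simp add: sum_distrib_left cvec.scale_sum_right sum_subtractf)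
  also have "\<dots> = (\<Sum>r\<in>R. if complex_of_real r = c then 0 else f r)"
    by (rule sum.cong) (simp_all add: diff)
  finally have "h * u - c *\<^sub>C u = (\<Sum>r\<in>R. f r) - (\<Sum>r\<in>R. if complex_of_real r = c then 0 else f r)"
    using z by (simp add: u_def algebra_simps cvec.scale_right_diff_distrib)
  also have "\<dots> = w"
    unfolding w_def sum_subtractf[symmetric] by (rule sum.cong) auto
  finally have u: "h * u - c *\<^sub>C u = w" .
  show ?thesis
  proof (cases "\<exists>r0. c = complex_of_real r0")
    case False
    then have "w = 0" by (auto simp: w_def intro!: sum.neutral)
    then have "h * u = c *\<^sub>C u" using u by simp
    moreover have "cnj c \<noteq> c"
      using False by (metis Reals_cases Reals_cnj_iff)
    ultimately have "u = 0" by (rule eigenvector_nonreal[OF h])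
    then have "y = (\<Sum>r\<in>R. g r)" by (simp add: u_def)
    then show ?thesis unfolding eigen_sum_def using R g by blast
  next
    case True
    then obtain r0 where c: "c = complex_of_real r0" by blast
    have hw: "h * w = c *\<^sub>C w"
      unfolding w_def sum_distrib_left cvec.scale_sum_right
      by (rule sum.cong) (auto simp: f)
    \<comment> \<open>With \<open>w = (h - c) u\<close> and \<open>h - c\<close> self-adjoint, \<open>star w * w = star u * (h - c) w = 0\<close>.\<close>
    have "star w * w = star u * (h * w - c *\<^sub>C w)"
      unfolding u[symmetric]
      by (simp add: star_diff star_mult star_scaleC h c algebra_simps mult_scaleC_left mult_scaleC_right)
    then have "w = 0" by (simp add: hw star_mult_self_eq_0)
    then have hu: "h * u = c *\<^sub>C u" using u by simp
    define f' where "f' r = (if r \<in> R then g r else 0) + (if r = r0 then u else 0)" for r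
    have "h * f' r = complex_of_real r *\<^sub>C f' r" for r
      by (auto simp: f'_def g hu c algebra_simps scaleC_add_right)
    moreover have "y = (\<Sum>r\<in>insert r0 R. f' r)"
    proof -
      have "(\<Sum>r\<in>insert r0 R. if r \<in> R then g r else 0) = (\<Sum>r\<in>R. g r)"
        using R by (intro sum.mono_neutral_cong_right) auto
      then show ?thesis using R by (simp add: f'_def sum.distrib u_def del: sum.insert sum.insert_if)
    qed
    ultimately show ?thesis unfolding eigen_sum_def using R by blast
  qed
qed

lemma eigen_sum_of_poly:
  fixes h :: "'a::cstar_algebra"
  assumes h: "star h = h"
  shows "p \<noteq> 0 \<Longrightarrow> eigen_sum h (alg_poly h p * y) \<Longrightarrow> eigen_sum h y"
proof (induction "degree p" arbitrary: p)
  case 0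
  then obtain c where p: "p = [:c:]" by (metis degree_eq_zeroE)
  then obtain R f where R: "finite R" "\<forall>r\<in>R. h * f r = complex_of_real r *\<^sub>C f r" "c *\<^sub>C y = (\<Sum>r\<in>R. f r)"
    using 0 unfolding eigen_sum_def by (auto simp: mult_scaleC_left)
  have "y = (1 / c) *\<^sub>C (c *\<^sub>C y)" using p 0 by (simp add: scaleC_scaleC)
  also have "\<dots> = (\<Sum>r\<in>R. (1 / c) *\<^sub>C f r)" by (simp only: R(3) cvec.scale_sum_right)
  finally show ?case unfolding eigen_sum_def using R(1,2)
    by (intro exI[of _ R] exI[of _ "\<lambda>r. (1 / c) *\<^sub>C f r"])
      (simp add: mult_scaleC_right scaleC_scaleC mult.commute)
next
  case (Suc n)
  then have "\<not> constant (poly p)" by (simp add: constant_degree)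
  then obtain c where "poly p c = 0" using fundamental_theorem_of_algebra by blast
  then obtain q where q: "p = [:- c, 1:] * q" by (auto simp: poly_eq_0_iff_dvd)
  with Suc have "q \<noteq> 0" by auto
  then have "degree p = Suc (degree q)" unfolding q by (subst degree_mult_eq) auto
  then have "n = degree q" using Suc by simp
  moreover have "eigen_sum h (h * (alg_poly h q * y) - c *\<^sub>C (alg_poly h q * y))"
    using Suc.prems(2) unfolding q alg_poly_linear_factor
    by (simp add: left_diff_distrib mult_scaleC_left mult.assoc)
  then have "eigen_sum h (alg_poly h q * y)" by (rule eigen_sum_of_shifted[OF h])
  ultimately show ?case using Suc.hyps(1) \<open>q \<noteq> 0\<close> by blast
qed

text \<open>The projections are required to be nonzero so that each coefficient of a combination
  \<open>\<Sum>r\<in>R. f r *\<^sub>C p r\<close> is bounded by the norm of that combination.\<close>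
definition resolution_of_one :: "'i set \<Rightarrow> ('i \<Rightarrow> 'a::star_algebra) \<Rightarrow> bool"
  where "resolution_of_one R p \<longleftrightarrow> finite R \<and> (\<forall>r\<in>R. is_projection (p r) \<and> p r \<noteq> 0) \<and>
    (\<forall>r\<in>R. \<forall>s\<in>R. r \<noteq> s \<longrightarrow> p r * p s = 0) \<and> (\<Sum>r\<in>R. p r) = 1"

lemma resolution_of_one_combine:
  assumes p: "resolution_of_one R p"
  shows "(\<Sum>r\<in>R. f r *\<^sub>C p r) * (\<Sum>r\<in>R. g r *\<^sub>C p r) = (\<Sum>r\<in>R. (f r * g r) *\<^sub>C p r)"
proof -
  have "(f r *\<^sub>C p r) * (\<Sum>s\<in>R. g s *\<^sub>C p s) = (f r * g r) *\<^sub>C p r" if "r \<in> R" for r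
  proof -
    have "(f r *\<^sub>C p r) * (\<Sum>s\<in>R. g s *\<^sub>C p s) = (\<Sum>s\<in>R. if s = r then (f r * g r) *\<^sub>C p r else 0)"
      unfolding sum_distrib_left using p that
      by (intro sum.cong) (auto simp: resolution_of_one_def is_projection_def mult_scaleC_left
          mult_scaleC_right scaleC_scaleC)
    then show ?thesis using p that by (simp add: resolution_of_one_def)
  qed
  then show ?thesis by (simp add: sum_distrib_right)
qed

lemma resolution_of_one_star:
  assumes "resolution_of_one R p"
  shows "star (\<Sum>r\<in>R. f r *\<^sub>C p r) = (\<Sum>r\<in>R. cnj (f r) *\<^sub>C p r)"
  using assms by (simp add: star_sum star_scaleC resolution_of_one_def is_projection_def)

lemma resolution_of_one_component:
  assumes "resolution_of_one R p" "r \<in> R"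
  shows "(\<Sum>s\<in>R. f s *\<^sub>C p s) * p r = f r *\<^sub>C p r"
proof -
  have "(\<Sum>s\<in>R. f s *\<^sub>C p s) * p r = (\<Sum>s\<in>R. if s = r then f r *\<^sub>C p r else 0)"
    unfolding sum_distrib_right using assms
    by (intro sum.cong) (auto simp: resolution_of_one_def is_projection_def mult_scaleC_left)
  then show ?thesis using assms by (simp add: resolution_of_one_def)
qed

text \<open>An annihilating polynomial splits into linear factors over the complex numbers; removing them one
  by one writes the unit as a sum of eigenvectors \<open>p r\<close> of \<open>h\<close>. Eigenvectors for different real
  eigenvalues satisfy \<open>star (p r) * p s = 0\<close>. Multiplying \<open>1 = \<Sum>s\<in>R. p s\<close> by \<open>star (p r)\<close> thus gives
  \<open>star (p r) = star (p r) * p r\<close>, which makes every \<open>p r\<close> a projection.\<close>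
theorem spectral_decomposition:
  fixes h :: "'a::fd_cstar_algebra"
  assumes h: "star h = h"
  obtains R p where "resolution_of_one R p" "h = (\<Sum>r\<in>R. complex_of_real r *\<^sub>C p r)"
proof -
  obtain q where "q \<noteq> 0" "alg_poly h q = 0" using ex_annihilating_poly by blast
  moreover have "eigen_sum h 0" unfolding eigen_sum_def
    by (intro exI[of _ "{}"]) simp
  ultimately have "eigen_sum h 1" using eigen_sum_of_poly[OF h, of q 1] by simp
  then obtain R0 p where R0: "finite R0" "\<And>r. r \<in> R0 \<Longrightarrow> h * p r = complex_of_real r *\<^sub>C p r"
    "1 = (\<Sum>r\<in>R0. p r)"
    unfolding eigen_sum_def by blast
  \<comment> \<open>Values \<open>r\<close> that are no eigenvalues contribute zero to the sum and are discarded.\<close>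
  define R where "R = {r \<in> R0. p r \<noteq> 0}"
  have "(\<Sum>r\<in>R. p r) = (\<Sum>r\<in>R0. p r)"
    unfolding R_def by (rule sum.mono_neutral_left) (use R0 in auto)
  then have R: "finite R" "\<And>r. r \<in> R \<Longrightarrow> h * p r = complex_of_real r *\<^sub>C p r"
    "1 = (\<Sum>r\<in>R. p r)"
    using R0 by (auto simp: R_def)
  have orth: "star (p r) * p s = 0" if "r \<in> R" "s \<in> R" "r \<noteq> s" for r s
  proof -
    have "complex_of_real r *\<^sub>C (star (p r) * p s) = star (h * p r) * p s"
      using that by (simp add: R star_scaleC mult_scaleC_left)
    also have "\<dots> = star (p r) * (h * p s)" by (simp add: star_mult h mult.assoc)
    also have "\<dots> = complex_of_real s *\<^sub>C (star (p r) * p s)"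
      using that by (simp add: R mult_scaleC_right)
    finally show ?thesis using that(3) cvec.scale_right_imp_eq of_real_eq_iff by metis
  qed
  have self: "star (p r) = star (p r) * p r" if "r \<in> R" for r
  proof -
    have "star (p r) = star (p r) * (\<Sum>s\<in>R. p s)" using R(3) by simp
    also have "\<dots> = (\<Sum>s\<in>R. if s = r then star (p r) * p r else 0)"
      unfolding sum_distrib_left using that by (intro sum.cong) (auto simp: orth)
    finally show ?thesis using R that by simp
  qed
  have sa: "star (p r) = p r" if "r \<in> R" for r
    by (metis self[OF that] star_mult star_star)
  show thesis
  proof (rule that)
    show "resolution_of_one R p"
      using R(1,3) self sa orth by (simp add: resolution_of_one_def is_projection_def R_def)
    have "h = h * (\<Sum>r\<in>R. p r)" using R(3) by simp
    also have "\<dots> = (\<Sum>r\<in>R. complex_of_real r *\<^sub>C p r)"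
      unfolding sum_distrib_left by (rule sum.cong) (simp_all add: R)
    finally show "h = (\<Sum>r\<in>R. complex_of_real r *\<^sub>C p r)" .
  qed
qed

section \<open>The trace of the left regular representation\<close>

text \<open>Both sides expand to the double sum of the products of the matrix entries of \<open>S\<close> and \<open>T\<close>. For
  \<open>S = id\<close> this says that the trace of an endomorphism does not depend on the basis, and for equal
  bases that the trace is commutative.\<close>
lemma trace_commute:
  fixes S :: "'b::complex_vector \<Rightarrow> 'a::complex_vector" and T :: "'a \<Rightarrow> 'b"
  assumes B: "finite B" "cvec.independent B" "cvec.span B = UNIV"
    and C: "finite C" "cvec.independent C" "cvec.span C = UNIV"
    and S: "clinear S" and T: "clinear T"
  shows "(\<Sum>b\<in>B. cvec.representation B (S (T b)) b) = (\<Sum>c\<in>C. cvec.representation C (T (S c)) c)"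
proof -
  have expand: "cvec.representation B' (F v) b = (\<Sum>c\<in>C'. cvec.representation C' v c * cvec.representation B' (F c) b)"
    if "finite B'" "cvec.independent B'" "cvec.span B' = UNIV"
      "finite C'" "cvec.independent C'" "cvec.span C' = UNIV" "clinear F"
    for B' :: "'x::complex_vector set" and C' :: "'y::complex_vector set" and F v b
  proof -
    interpret F: Vector_Spaces.linear scaleC scaleC F by (rule that)
    have "F v = F (\<Sum>c\<in>C'. cvec.representation C' v c *\<^sub>C c)"
      using that by (subst cvec.sum_representation_eq) auto
    also have "\<dots> = (\<Sum>c\<in>C'. cvec.representation C' v c *\<^sub>C F c)"
      by (simp add: F.sum F.scale)
    finally show ?thesis
      using that by (simp add: cvec.representation_sum cvec.representation_scale)
  qed
  have "(\<Sum>b\<in>B. cvec.representation B (S (T b)) b) =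
      (\<Sum>b\<in>B. \<Sum>c\<in>C. cvec.representation C (T b) c * cvec.representation B (S c) b)"
    by (intro sum.cong refl expand[OF B C S])
  also have "\<dots> = (\<Sum>c\<in>C. \<Sum>b\<in>B. cvec.representation B (S c) b * cvec.representation C (T b) c)"
    by (subst sum.swap) (simp add: mult.commute)
  also have "\<dots> = (\<Sum>c\<in>C. cvec.representation C (T (S c)) c)"
    by (intro sum.cong refl expand[OF C B T, symmetric])
  finally show ?thesis .
qed

lemma clinear_id: "clinear id"
  by unfold_locales simp_all

lemma clinear_mult_left: "clinear (\<lambda>x. a * x :: 'a::star_algebra)"
  by unfold_locales (simp_all add: distrib_left mult_scaleC_right)

definition reg_trace :: "'a::fd_cstar_algebra \<Rightarrow> complex"
  where "reg_trace a = (\<Sum>b\<in>some_basis. cvec.representation some_basis (a * b) b)"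

lemma reg_trace_basis:
  assumes "finite B" "cvec.independent B" "cvec.span B = UNIV"
  shows "reg_trace a = (\<Sum>b\<in>B. cvec.representation B (a * b) b)"
  unfolding reg_trace_def
  using trace_commute[OF some_basis assms clinear_id clinear_mult_left[of a]] by simp

lemma reg_trace_add: "reg_trace (a + b) = reg_trace a + reg_trace b"
  by (simp add: reg_trace_def distrib_right cvec.representation_add some_basis sum.distrib)

lemma reg_trace_scaleC: "reg_trace (c *\<^sub>C a) = c * reg_trace a"
  by (simp add: reg_trace_def mult_scaleC_left cvec.representation_scale some_basis sum_distrib_left)

lemma reg_trace_0 [simp]: "reg_trace 0 = 0"
  using reg_trace_scaleC[of 0 0] by simp

lemma reg_trace_sum: "reg_trace (\<Sum>i\<in>I. f i) = (\<Sum>i\<in>I. reg_trace (f i))"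
  by (induction I rule: infinite_finite_induct) (simp_all add: reg_trace_add)

lemma reg_trace_diff: "reg_trace (a - b) = reg_trace a - reg_trace b"
  using reg_trace_add[of "a - b" b] by simp

lemma reg_trace_commute: "reg_trace (a * b) = reg_trace (b * a)"
  unfolding reg_trace_def mult.assoc
  by (rule trace_commute[OF some_basis some_basis clinear_mult_left clinear_mult_left])

text \<open>The trace of an idempotent operator is its rank: in a basis that extends a basis of the range,
  exactly the basis vectors in the range contribute, each of them \<open>1\<close>.\<close>
lemma reg_trace_idempotent:
  fixes p :: "'a::fd_cstar_algebra"
  assumes p: "p * p = p"
  shows "\<exists>n. reg_trace p = of_nat n \<and> (p \<noteq> 0 \<longrightarrow> n > 0)"
proof -
  define V where "V = range (\<lambda>x. p * x)"
  have fixed: "p * v = v" if "v \<in> V" for v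
    using that p by (auto simp: V_def mult.assoc[symmetric])
  obtain S where S: "S \<subseteq> V" "cvec.independent S" "V \<subseteq> cvec.span S"
    using cvec.maximal_independent_subset[of V] by blast
  define B where "B = cvec.extend_basis S"
  have B: "S \<subseteq> B" "cvec.independent B" "cvec.span B = UNIV"
    using cvec.extend_basis_superset[OF S(2)] cvec.independent_extend_basis[OF S(2)]
      cvec.span_extend_basis[OF S(2)] by (simp_all add: B_def)
  have finB: "finite B"
    using cvec.independent_span_bound[OF some_basis(1) B(2)] some_basis(3) by auto
  have coord: "cvec.representation B (p * b) b = (if b \<in> S then 1 else 0)" if "b \<in> B" for b
  proof (cases "b \<in> S")
    case True
    then have "p * b = b" using S fixed by auto
    then show ?thesis using True cvec.representation_basis[OF B(2) that] by simp
  next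
    case False
    have "p * b \<in> cvec.span S" using S(3) by (auto simp: V_def)
    then have "cvec.representation B (p * b) = cvec.representation S (p * b)"
      by (rule cvec.representation_extend[OF B(2) _ B(1)])
    then show ?thesis using False cvec.representation_ne_zero[of S "p * b" b] by auto
  qed
  have "reg_trace p = (\<Sum>b\<in>B. if b \<in> S then 1 else 0)"
    unfolding reg_trace_basis[OF finB B(2,3)] by (rule sum.cong) (simp_all add: coord)
  also have "\<dots> = of_nat (card S)"
    using finB B(1) by (simp add: sum.If_cases Int_absorb1)
  finally have "reg_trace p = of_nat (card S)" .
  moreover have "card S > 0" if "p \<noteq> 0"
  proof -
    have "p \<in> V" using p unfolding V_def by (metis rangeI)
    with S(3) that have "S \<noteq> {}" by auto
    then show ?thesis using finB B(1) finite_subset by (metis card_gt_0_iff)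
  qed
  ultimately show ?thesis by blast
qed

lemma reg_trace_selfadjoint:
  assumes h: "star h = (h::'a::fd_cstar_algebra)"
  shows "\<exists>t. reg_trace h = complex_of_real t"
    and "\<exists>t. reg_trace (h * h) = complex_of_real t \<and> t \<ge> 0 \<and> (t = 0 \<longrightarrow> h = 0)"
proof -
  obtain R p where res: "resolution_of_one R p" and hp: "h = (\<Sum>r\<in>R. complex_of_real r *\<^sub>C p r)"
    by (rule spectral_decomposition[OF h])
  then have R: "finite R" "\<forall>r\<in>R. is_projection (p r) \<and> p r \<noteq> 0"
    by (simp_all add: resolution_of_one_def)
  have "\<forall>r\<in>R. \<exists>n::nat. n > 0 \<and> reg_trace (p r) = of_nat n"
  proof
    fix r
    assume "r \<in> R"
    with R(2) have "p r * p r = p r" "p r \<noteq> 0" by (auto simp: is_projection_def)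
    then show "\<exists>n::nat. n > 0 \<and> reg_trace (p r) = of_nat n"
      using reg_trace_idempotent[of "p r"] by blast
  qed
  from bchoice[OF this] obtain n :: "real \<Rightarrow> nat"
    where n: "\<forall>r\<in>R. n r > 0 \<and> reg_trace (p r) = of_nat (n r)" by blast
  have "reg_trace h = complex_of_real (\<Sum>r\<in>R. r * n r)"
    by (simp add: hp reg_trace_sum reg_trace_scaleC n)
  then show "\<exists>t. reg_trace h = complex_of_real t" by blast
  have "h * h = (\<Sum>r\<in>R. complex_of_real (r * r) *\<^sub>C p r)"
    unfolding hp resolution_of_one_combine[OF res] by simp
  then have "reg_trace (h * h) = complex_of_real (\<Sum>r\<in>R. r * r * n r)"
    by (simp add: reg_trace_sum reg_trace_scaleC n)
  moreover have "h = 0" if "(\<Sum>r\<in>R. r * r * n r) = 0"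
  proof -
    have "r * r * n r = 0" if "r \<in> R" for r
      using \<open>(\<Sum>r\<in>R. r * r * n r) = 0\<close> R(1) that by (subst (asm) sum_nonneg_eq_0_iff) auto
    then have "r = 0" if "r \<in> R" for r using n that by force
    then show ?thesis unfolding hp by (intro sum.neutral) auto
  qed
  ultimately show "\<exists>t. reg_trace (h * h) = complex_of_real t \<and> t \<ge> 0 \<and> (t = 0 \<longrightarrow> h = 0)"
    by (intro exI[of _ "\<Sum>r\<in>R. r * r * n r"]) (auto intro: sum_nonneg)
qed

text \<open>This reduces statements about all elements to self-adjoint ones.\<close>
lemma cartesian_decomposition:
  fixes x :: "'a::star_algebra"
  obtains a b where "star a = a" "star b = b" "x = a + \<i> *\<^sub>C b"
proof -
  define a where "a = (1 / 2) *\<^sub>C (x + star x)"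
  define b where "b = (- \<i> / 2) *\<^sub>C (x - star x)"
  show thesis
  proof (rule that)
    show "star a = a" by (simp add: a_def star_scaleC star_add star_star add.commute)
    show "star b = b"
      by (simp add: b_def star_scaleC star_diff star_star cvec.scale_right_diff_distrib)
    have "a + \<i> *\<^sub>C b = (1 / 2 + 1 / 2) *\<^sub>C x"
      unfolding a_def b_def scaleC_add_left
      by (simp add: scaleC_scaleC scaleC_add_right cvec.scale_right_diff_distrib)
    then show "x = a + \<i> *\<^sub>C b" by simp
  qed
qed

lemma reg_trace_star: "reg_trace (star x) = cnj (reg_trace x)"
proof -
  obtain a b where ab: "star a = a" "star b = b" "x = a + \<i> *\<^sub>C b"
    by (rule cartesian_decomposition)
  obtain s t where st: "reg_trace a = complex_of_real s" "reg_trace b = complex_of_real t"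
    using reg_trace_selfadjoint(1) ab by blast
  have "star x = a + (- \<i>) *\<^sub>C b"
    unfolding ab(3) star_add star_scaleC by (simp only: ab(1,2) complex_cnj_i)
  then have "reg_trace (star x) = complex_of_real s - \<i> * complex_of_real t"
    by (simp only: reg_trace_add reg_trace_scaleC st) simp
  moreover have "reg_trace x = complex_of_real s + \<i> * complex_of_real t"
    by (simp only: ab(3) reg_trace_add reg_trace_scaleC st)
  ultimately show ?thesis by simp
qed

text \<open>For \<open>x = a + \<i> b\<close> with self-adjoint
  \<open>a\<close> and \<open>b\<close>, the commutator in \<open>star x * x = a\<^sup>2 + b\<^sup>2 + \<i> (a b - b a)\<close> has trace zero, and the
  traces of \<open>a\<^sup>2\<close> and \<open>b\<^sup>2\<close> are read off from the spectral decompositions.\<close>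
lemma reg_trace_positive:
  "\<exists>t. reg_trace (star x * x) = complex_of_real t \<and> t \<ge> 0 \<and> (t = 0 \<longrightarrow> x = 0)"
proof -
  obtain a b where ab: "star a = a" "star b = b" "x = a + \<i> *\<^sub>C b"
    by (rule cartesian_decomposition)
  have "star x * x = a * a + b * b + \<i> *\<^sub>C (a * b - b * a)"
    by (simp add: ab star_add star_scaleC algebra_simps mult_scaleC_left mult_scaleC_right
        scaleC_scaleC cvec.scale_right_diff_distrib)
  then have sum: "reg_trace (star x * x) = reg_trace (a * a) + reg_trace (b * b)"
    by (simp add: reg_trace_add reg_trace_scaleC reg_trace_diff reg_trace_commute[of b a])
  obtain s where s: "reg_trace (a * a) = complex_of_real s" "s \<ge> 0" "s = 0 \<longrightarrow> a = 0"
    using reg_trace_selfadjoint(2)[OF ab(1)] by blast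
  obtain t where t: "reg_trace (b * b) = complex_of_real t" "t \<ge> 0" "t = 0 \<longrightarrow> b = 0"
    using reg_trace_selfadjoint(2)[OF ab(2)] by blast
  have "x = 0" if "s + t = 0"
    using that s(2,3) t(2,3) ab(3) by (simp add: add_nonneg_eq_0_iff)
  then show ?thesis
    using sum s t by (intro exI[of _ "s + t"]) simp
qed

lemma Re_reg_trace_nonneg: "Re (reg_trace (star x * x)) \<ge> 0"
  using reg_trace_positive[of x] by auto

lemma Re_reg_trace_eq_0: "Re (reg_trace (star x * x)) = 0 \<Longrightarrow> x = 0"
  using reg_trace_positive[of x] by auto

text \<open>Orthonormality for the inner product \<open>\<langle>b, c\<rangle> = reg_trace (star b * c)\<close>\<close>
definition orthonormal :: "'a::fd_cstar_algebra set \<Rightarrow> bool"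
  where "orthonormal S \<longleftrightarrow> (\<forall>b\<in>S. \<forall>c\<in>S. reg_trace (star b * c) = (if b = c then 1 else 0))"

lemma orthonormal_coefficient:
  assumes "orthonormal S" "finite T" "T \<subseteq> S" "c \<in> S"
  shows "reg_trace (star c * (\<Sum>b\<in>T. u b *\<^sub>C b)) = (if c \<in> T then u c else 0)"
proof -
  have "reg_trace (star c * (\<Sum>b\<in>T. u b *\<^sub>C b)) = (\<Sum>b\<in>T. u b * reg_trace (star c * b))"
    by (simp add: sum_distrib_left reg_trace_sum mult_scaleC_right reg_trace_scaleC)
  also have "\<dots> = (\<Sum>b\<in>T. if b = c then u c else 0)"
    using assms by (intro sum.cong) (auto simp: orthonormal_def subset_iff)
  finally show ?thesis using assms(2) by simp
qed

lemma orthonormal_independent: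
  assumes "orthonormal S"
  shows "cvec.independent S"
  unfolding cvec.dependent_explicit
proof clarify
  fix T u v
  assume T: "finite T" "T \<subseteq> S" "(\<Sum>v\<in>T. u v *\<^sub>C v) = 0" "v \<in> T" "u v \<noteq> 0"
  then have "u v = 0"
    using orthonormal_coefficient[OF assms T(1,2), of v u] by (auto simp: subset_iff)
  with T show False by simp
qed

definition orthonormal_basis :: "'a::fd_cstar_algebra set \<Rightarrow> bool"
  where "orthonormal_basis S \<longleftrightarrow> finite S \<and> orthonormal S \<and>
    (\<forall>x. (\<Sum>b\<in>S. reg_trace (star b * x) *\<^sub>C b) = x)"

text \<open>Orthonormal sets are independent, so there is one of maximal cardinality. If the expansion
  of some \<open>x\<close> failed, the normalised remainder could be added to the set.\<close>
lemma ex_orthonormal_basis: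
  obtains S :: "'a::fd_cstar_algebra set"
  where "orthonormal_basis S"
proof -
  let ?P = "\<lambda>S :: 'a set. finite S \<and> orthonormal S"
  have bound: "finite S \<and> card S \<le> card (some_basis :: 'a set)" if "orthonormal S" for S :: "'a set"
    using cvec.independent_span_bound[OF some_basis(1) orthonormal_independent[OF that]]
    by (simp add: some_basis)
  have empty: "?P {}" by (simp add: orthonormal_def)
  have "\<forall>S. ?P S \<longrightarrow> card S < Suc (card (some_basis :: 'a set))"
    using bound by (simp add: less_Suc_eq_le)
  from ex_has_greatest_nat[of ?P, OF empty this] obtain S :: "'a set" where S: "?P S" and max: "\<And>T. ?P T \<Longrightarrow> card T \<le> card S"
    by blast
  have "(\<Sum>b\<in>S. reg_trace (star b * x) *\<^sub>C b) = x" for x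
  proof (rule ccontr)
    define v where "v = x - (\<Sum>b\<in>S. reg_trace (star b * x) *\<^sub>C b)"
    assume "(\<Sum>b\<in>S. reg_trace (star b * x) *\<^sub>C b) \<noteq> x"
    then have "v \<noteq> 0" by (simp add: v_def)
    have orth: "reg_trace (star c * v) = 0" if "c \<in> S" for c
      unfolding v_def right_diff_distrib reg_trace_diff
      using S that by (subst orthonormal_coefficient[of S]) auto
    obtain t where t: "reg_trace (star v * v) = complex_of_real t" "t > 0"
      using reg_trace_positive[of v] \<open>v \<noteq> 0\<close> by force
    define w where "w = complex_of_real (1 / sqrt t) *\<^sub>C v"
    have "complex_of_real (1 / sqrt t) * complex_of_real (1 / sqrt t) * complex_of_real t = 1"
      unfolding of_real_mult[symmetric] using t(2) by (simp add: real_div_sqrt divide_simps)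
    then have ww: "reg_trace (star w * w) = 1"
      by (simp add: w_def star_scaleC mult_scaleC_left mult_scaleC_right scaleC_scaleC
          reg_trace_scaleC t(1) del: of_real_divide)
    have cw: "reg_trace (star c * w) = 0" if "c \<in> S" for c
      by (simp add: w_def mult_scaleC_right reg_trace_scaleC orth that)
    have wc: "reg_trace (star w * c) = 0" if "c \<in> S" for c
      using cw[OF that] reg_trace_star[of "star c * w"] by (simp add: star_mult star_star)
    have "w \<notin> S" using cw ww by force
    have "orthonormal (insert w S)"
      using S ww cw wc \<open>w \<notin> S\<close> unfolding orthonormal_def by auto
    then have "card (insert w S) \<le> card S" using max S by blast
    with S \<open>w \<notin> S\<close> show False by simp
  qed
  with S have "orthonormal_basis S" by (simp add: orthonormal_basis_def)
  then show thesis by (rule that)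
qed

text \<open>In an orthonormal basis the trace of left multiplication by \<open>a\<close> is
  \<open>\<Sum>b\<in>S. reg_trace (star b * a * b) = reg_trace (a * (\<Sum>b\<in>S. b * star b))\<close>. Since this trace is
  \<open>reg_trace a\<close> itself, faithfulness gives the claim. This normalisation is special to the trace of
  the regular representation, and it makes \<open>casimir S\<close> below idempotent.\<close>
lemma orthonormal_basis_sum_mult_star:
  fixes S :: "'a::fd_cstar_algebra set"
  assumes "orthonormal_basis S"
  shows "(\<Sum>b\<in>S. b * star b) = 1" (is "?s = 1")
proof -
  have S: "finite S" "orthonormal S" and expand: "x = (\<Sum>b\<in>S. reg_trace (star b * x) *\<^sub>C b)" for x
    using assms by (simp_all add: orthonormal_basis_def)
  have span: "cvec.span S = UNIV"
  proof -
    have "x \<in> cvec.span S" for x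
      by (subst expand[of x]) (auto intro: cvec.span_sum cvec.span_scale cvec.span_base)
    then show ?thesis by auto
  qed
  note ind = orthonormal_independent[OF S(2)]
  have coord: "cvec.representation S x b = reg_trace (star b * x)" if "b \<in> S" for x b
  proof -
    have "cvec.representation S x b = 
       (\<Sum>c\<in>S. reg_trace (star c * x) * cvec.representation S c b)"
      by (subst expand[of x]) (simp add: cvec.representation_sum cvec.representation_scale ind span)
    also have "\<dots> = (\<Sum>c\<in>S. if c = b then reg_trace (star b * x) else 0)"
      by (rule sum.cong) (simp_all add: cvec.representation_basis[OF ind])
    finally show ?thesis using S(1) that by simp
  qed
  have tr: "reg_trace a = reg_trace (a * ?s)" for a
  proof -
    have "reg_trace a = (\<Sum>b\<in>S. reg_trace (star b * (a * b)))"
      by (simp add: reg_trace_basis[OF S(1) ind span] coord)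
    also have "\<dots> = (\<Sum>b\<in>S. reg_trace (a * (b * star b)))"
      using reg_trace_commute[of "star _" "a * _"] by (intro sum.cong) (simp_all add: mult.assoc)
    finally show ?thesis by (simp add: sum_distrib_left reg_trace_sum)
  qed
  have "reg_trace (star (?s - 1) * (?s - 1)) = 0"
    using tr[of "star (?s - 1)"] by (simp add: right_diff_distrib reg_trace_diff)
  then have "?s - 1 = 0" by (intro Re_reg_trace_eq_0) simp
  then show ?thesis by simp
qed

section \<open>The diagonal projection as a Casimir element\<close>

lemma Op_add: "Op (x + y) = Op x + Op y"
  and Op_diff: "Op (x - y) = Op x - Op y"
  and Op_scaleC: "Op (c *\<^sub>C x) = c *\<^sub>C Op x"
  and Op_0: "Op 0 = 0"
  by (simp_all add: unop_inject[symmetric] plus_opposite.rep_eq minus_opposite.rep_eq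
      scaleC_opposite.rep_eq zero_opposite.rep_eq Op_inverse)

lemma Op_mult: "Op x * Op y = Op (y * x)"
  and Op_1: "Op 1 = 1"
  and Op_star: "star (Op x) = Op (star x)"
  by (simp_all add: unop_inject[symmetric] times_opposite.rep_eq one_opposite.rep_eq
      star_opposite.rep_eq Op_inverse)

lemma Op_sum: "Op (\<Sum>i\<in>I. f i) = (\<Sum>i\<in>I. Op (f i))"
  by (induction I rule: infinite_finite_induct) (simp_all add: Op_add Op_0)

lemma tensor_zero_left [simp]: "0 \<otimes>\<^sub>t b = 0"
  using tensor_scaleC_left[of 0 0 b] by simp

lemma tensor_zero_right [simp]: "a \<otimes>\<^sub>t 0 = 0"
  using tensor_scaleC_right[of a 0 0] by simp

lemma tensor_diff_left: "(a - a') \<otimes>\<^sub>t b = a \<otimes>\<^sub>t b - a' \<otimes>\<^sub>t b"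
  using tensor_add_left[of "a - a'" a' b] by simp

lemma tensor_diff_right: "a \<otimes>\<^sub>t (b - b') = a \<otimes>\<^sub>t b - a \<otimes>\<^sub>t b'"
  using tensor_add_right[of a "b - b'" b'] by simp

lemma tensor_sum_left: "(\<Sum>i\<in>I. f i) \<otimes>\<^sub>t b = (\<Sum>i\<in>I. f i \<otimes>\<^sub>t b)"
  by (induction I rule: infinite_finite_induct) (simp_all add: tensor_add_left)

lemma tensor_sum_right: "a \<otimes>\<^sub>t (\<Sum>i\<in>I. f i) = (\<Sum>i\<in>I. a \<otimes>\<^sub>t f i)"
  by (induction I rule: infinite_finite_induct) (simp_all add: tensor_add_right)

text \<open>Projections span the algebra by the spectral decomposition.\<close>
lemma projection_induct [case_names projection add scaleC]:
  fixes a :: "'a::fd_cstar_algebra"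
  assumes proj: "\<And>p. is_projection p \<Longrightarrow> P p"
    and add: "\<And>x y. P x \<Longrightarrow> P y \<Longrightarrow> P (x + y)"
    and scaleC: "\<And>c x. P x \<Longrightarrow> P (c *\<^sub>C x)"
  shows "P a"
proof -
  have "P 0" by (rule proj) (simp add: is_projection_def)
  have sum: "P (\<Sum>i\<in>I. f i)" if "\<And>i. i \<in> I \<Longrightarrow> P (f i)" for I and f :: "real \<Rightarrow> 'a"
    using that by (induction I rule: infinite_finite_induct) (simp_all add: \<open>P 0\<close> add)
  have sa: "P h" if h: "star h = h" for h :: 'a
  proof -
    obtain R p where "resolution_of_one R p" "h = (\<Sum>r\<in>R. complex_of_real r *\<^sub>C p r)"
      by (rule spectral_decomposition[OF h])
    then have "\<forall>r\<in>R. is_projection (p r)" "h = (\<Sum>r\<in>R. complex_of_real r *\<^sub>C p r)"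
      by (simp_all add: resolution_of_one_def)
    then show ?thesis using sum[of R "\<lambda>r. complex_of_real r *\<^sub>C p r"] scaleC proj by simp
  qed
  obtain x y where "star x = x" "star y = y" "a = x + \<i> *\<^sub>C y"
    by (rule cartesian_decomposition)
  then show ?thesis using sa add scaleC by simp
qed

text \<open>The canonical element of \<open>A \<otimes> A\<^sup>o\<^sup>p\<close> for the trace form. In a sum of full matrix algebras it
  is the sum over the blocks of \<open>(1 / n) (\<Sum>i j. e\<^sub>i\<^sub>j \<otimes> e\<^sub>j\<^sub>i)\<close>, where \<open>n\<close> is the size of the block.\<close>
definition casimir :: "'a::fd_cstar_algebra set \<Rightarrow> ('a, 'a opposite) tensor"
  where "casimir S = (\<Sum>b\<in>S. b \<otimes>\<^sub>t Op (star b))"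

context
  fixes S :: "'a::fd_cstar_algebra set"
  assumes S: "orthonormal_basis S"
begin

lemma basis_expand: "x = (\<Sum>b\<in>S. reg_trace (star b * x) *\<^sub>C b)"
  using S by (simp add: orthonormal_basis_def)

text \<open>The adjoint of the expansion of \<open>star x\<close>\<close>
lemma basis_expand_star: "x = (\<Sum>b\<in>S. reg_trace (x * b) *\<^sub>C star b)"
proof -
  have "x = star (\<Sum>b\<in>S. reg_trace (star b * star x) *\<^sub>C b)"
    unfolding basis_expand[of "star x", symmetric] by (rule star_star[symmetric])
  also have "\<dots> = (\<Sum>b\<in>S. cnj (reg_trace (star b * star x)) *\<^sub>C star b)"
    by (simp add: star_sum star_scaleC)
  also have "\<dots> = (\<Sum>b\<in>S. reg_trace (x * b) *\<^sub>C star b)"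
    by (simp add: reg_trace_star[symmetric] star_mult star_star)
  finally show ?thesis .
qed

text \<open>Expanding \<open>a * b\<close> in the basis on one side, and \<open>star c * a\<close> in the adjoint basis on the other,
  produces the same double sum.\<close>
lemma casimir_balanced_left: "(a \<otimes>\<^sub>t 1) * casimir S = (1 \<otimes>\<^sub>t Op a) * casimir S"
proof -
  have "(a \<otimes>\<^sub>t 1) * casimir S = (\<Sum>b\<in>S. (a * b) \<otimes>\<^sub>t Op (star b))"
    by (simp add: casimir_def sum_distrib_left tensor_mult_pure)
  also have "\<dots> = (\<Sum>b\<in>S. \<Sum>c\<in>S. reg_trace (star c * (a * b)) *\<^sub>C (c \<otimes>\<^sub>t Op (star b)))"
    by (intro sum.cong refl, subst basis_expand[of "a * _"])
      (simp add: tensor_sum_left tensor_scaleC_left)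
  also have "\<dots> = (\<Sum>c\<in>S. \<Sum>b\<in>S. reg_trace ((star c * a) * b) *\<^sub>C (c \<otimes>\<^sub>t Op (star b)))"
    by (subst sum.swap) (simp add: mult.assoc)
  also have "\<dots> = (\<Sum>c\<in>S. c \<otimes>\<^sub>t Op (star c * a))"
    by (intro sum.cong refl, subst (2) basis_expand_star)
      (simp add: Op_sum Op_scaleC tensor_sum_right tensor_scaleC_right)
  also have "\<dots> = (1 \<otimes>\<^sub>t Op a) * casimir S"
    by (simp add: casimir_def sum_distrib_left tensor_mult_pure Op_mult)
  finally show ?thesis .
qed

lemma casimir_eq_swapped: "casimir S = (\<Sum>b\<in>S. star b \<otimes>\<^sub>t Op b)"
proof -
  have "casimir S = (\<Sum>c\<in>S. \<Sum>b\<in>S. reg_trace (star b * star c) *\<^sub>C (c \<otimes>\<^sub>t Op b))"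
    unfolding casimir_def
    by (intro sum.cong refl, subst basis_expand[of "star _"])
      (simp add: Op_sum Op_scaleC tensor_sum_right tensor_scaleC_right)
  also have "\<dots> = (\<Sum>b\<in>S. \<Sum>c\<in>S. reg_trace (star c * star b) *\<^sub>C (c \<otimes>\<^sub>t Op b))"
    by (subst sum.swap) (simp add: reg_trace_commute)
  also have "\<dots> = (\<Sum>b\<in>S. star b \<otimes>\<^sub>t Op b)"
    by (intro sum.cong refl, subst (2) basis_expand) (simp add: tensor_sum_left tensor_scaleC_left)
  finally show ?thesis .
qed

lemma star_casimir: "star (casimir S) = casimir S"
  by (subst (2) casimir_eq_swapped) (simp add: casimir_def star_sum tensor_star_pure Op_star star_star)

lemma casimir_balanced_right: "casimir S * (a \<otimes>\<^sub>t 1) = casimir S * (1 \<otimes>\<^sub>t Op a)"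
proof -
  have "star (star (casimir S) * (a \<otimes>\<^sub>t 1)) = star (star (casimir S) * (1 \<otimes>\<^sub>t Op a))"
    using casimir_balanced_left[of "star a"]
    by (simp add: star_mult tensor_star_pure star_star Op_star)
  then show ?thesis by (metis star_star star_casimir)
qed

text \<open>A factor \<open>star b \<otimes> Op b\<close> next to such a \<open>d\<close> can be moved into the first leg, where the sum
  of the \<open>b * star b\<close> is the unit.\<close>
lemma mult_casimir_of_balanced:
  assumes d: "\<And>a. d * (a \<otimes>\<^sub>t 1) = d * (1 \<otimes>\<^sub>t Op a)"
  shows "d * casimir S = d"
proof -
  have "d * (star b \<otimes>\<^sub>t Op b) = d * ((b * star b) \<otimes>\<^sub>t 1)" for b
  proof -
    have "d * (star b \<otimes>\<^sub>t Op b) = d * (1 \<otimes>\<^sub>t Op b) * (star b \<otimes>\<^sub>t 1)"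
      by (simp add: mult.assoc tensor_mult_pure)
    also have "\<dots> = d * ((b * star b) \<otimes>\<^sub>t 1)"
      unfolding d[symmetric] by (simp add: mult.assoc tensor_mult_pure)
    finally show ?thesis .
  qed
  then have "d * casimir S = d * ((\<Sum>b\<in>S. b * star b) \<otimes>\<^sub>t 1)"
    by (simp add: casimir_eq_swapped sum_distrib_left tensor_sum_left)
  then show ?thesis
    by (simp add: orthonormal_basis_sum_mult_star[OF S] one_tensor_def[symmetric])
qed

lemma casimir_projection: "is_projection (casimir S)"
  using star_casimir mult_casimir_of_balanced[OF casimir_balanced_right]
  by (simp add: is_projection_def)

lemma casimir_orthogonal: "orthogonal_to_offdiagonal (casimir S)"
proof -
  have "casimir S * (p \<otimes>\<^sub>t Op (1 - p)) = 0" if "is_projection p" for p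
  proof -
    have "casimir S * (p \<otimes>\<^sub>t Op (1 - p)) = casimir S * (p \<otimes>\<^sub>t 1) * (1 \<otimes>\<^sub>t Op (1 - p))"
      by (simp add: mult.assoc tensor_mult_pure)
    also have "\<dots> = casimir S * (1 \<otimes>\<^sub>t Op ((1 - p) * p))"
      by (simp add: casimir_balanced_right mult.assoc tensor_mult_pure Op_mult)
    also have "(1 - p) * p = 0"
      using that by (simp add: is_projection_def left_diff_distrib)
    finally show ?thesis by (simp add: Op_0)
  qed
  then show ?thesis by (simp add: orthogonal_to_offdiagonal_def orthogonal_proj_def)
qed

end

text \<open>For a projection \<open>p\<close>, orthogonality to \<open>p \<otimes> (1 - p)\<close> and to \<open>(1 - p) \<otimes> p\<close> shows that
  \<open>d (p \<otimes> 1)\<close> and \<open>d (1 \<otimes> p)\<close> both equal \<open>d (p \<otimes> p)\<close>.\<close>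
lemma balanced_of_orthogonal:
  fixes d :: "('a::fd_cstar_algebra, 'a opposite) tensor"
  assumes "orthogonal_to_offdiagonal d"
  shows "d * (a \<otimes>\<^sub>t 1) = d * (1 \<otimes>\<^sub>t Op a)"
proof (induction a rule: projection_induct)
  case (projection p)
  have q: "is_projection (1 - p)"
    using projection by (simp add: is_projection_def star_diff algebra_simps)
  have "d * (p \<otimes>\<^sub>t Op (1 - p)) = 0" "d * ((1 - p) \<otimes>\<^sub>t Op (1 - (1 - p))) = 0"
    using assms projection q by (simp_all only: orthogonal_to_offdiagonal_def orthogonal_proj_def)
  then have "d * (p \<otimes>\<^sub>t 1) = d * (p \<otimes>\<^sub>t Op p)" "d * (1 \<otimes>\<^sub>t Op p) = d * (p \<otimes>\<^sub>t Op p)"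
    by (simp_all add: Op_diff Op_1 tensor_diff_left tensor_diff_right right_diff_distrib)
  then show ?case by simp
next
  case (add x y)
  then show ?case by (simp add: tensor_add_left tensor_add_right Op_add distrib_left)
next
  case (scaleC c x)
  then show ?case by (simp add: tensor_scaleC_left tensor_scaleC_right Op_scaleC mult_scaleC_right)
qed

text \<open>The Casimir element is itself one of the projections over which \<open>d\<close> is the maximum, so it lies
  below \<open>d\<close>. Conversely \<open>d\<close> is balanced, so \<open>d * casimir S = d\<close>.\<close>
theorem diagonal_projection_eq_casimir:
  assumes d: "is_diagonal_projection d" and S: "orthonormal_basis S"
  shows "d = casimir S"
proof -
  have "d * casimir S = d"
    using d by (intro mult_casimir_of_balanced[OF S] balanced_of_orthogonal)
      (simp add: is_diagonal_projection_def)
  moreover have "casimir S * d = casimir S"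
    using d casimir_projection[OF S] casimir_orthogonal[OF S]
    by (simp add: is_diagonal_projection_def proj_le_def)
  moreover have "star d = d"
    using d by (simp add: is_diagonal_projection_def is_projection_def)
  ultimately show ?thesis
    by (metis star_casimir[OF S] star_mult)
qed

section \<open>Uniqueness of the C*-norm and contractivity\<close>

text \<open>The conditions of \<^const>\<open>is_cstar_norm_mat\<close> for the algebra itself instead of its matrices\<close>
definition is_cstar_norm :: "('a::star_algebra \<Rightarrow> real) \<Rightarrow> bool"
  where "is_cstar_norm N \<longleftrightarrow> (\<forall>x. N x = 0 \<longleftrightarrow> x = 0) \<and> (\<forall>x y. N (x + y) \<le> N x + N y) \<and>
    (\<forall>c x. N (c *\<^sub>C x) = cmod c * N x) \<and> (\<forall>x y. N (x * y) \<le> N x * N y) \<and>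
    (\<forall>x. N (star x * x) = (N x)\<^sup>2)"

lemma is_cstar_normD:
  assumes "is_cstar_norm N"
  shows "N x = 0 \<longleftrightarrow> x = 0" "N (x + y) \<le> N x + N y" "N (c *\<^sub>C x) = cmod c * N x"
    "N (x * y) \<le> N x * N y" "N (star x * x) = (N x)\<^sup>2"
  using assms by (simp_all add: is_cstar_norm_def)

lemma is_cstar_norm_norm: "is_cstar_norm (norm :: 'a::cstar_algebra \<Rightarrow> real)"
  by (simp add: is_cstar_norm_def norm_triangle_ineq norm_scaleC norm_mult_ineq norm_star_mult)

lemma cstar_norm_nonneg:
  assumes "is_cstar_norm N"
  shows "N x \<ge> 0"
proof -
  have "N (x + (- 1) *\<^sub>C x) \<le> N x + N ((- 1) *\<^sub>C x)"
    by (rule is_cstar_normD(2)[OF assms])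
  moreover have "N ((- 1) *\<^sub>C x) = N x"
    by (subst is_cstar_normD(3)[OF assms]) simp
  moreover have "N (x + (- 1) *\<^sub>C x) = 0"
    by (subst is_cstar_normD(1)[OF assms]) simp
  ultimately show ?thesis by simp
qed

lemma cstar_norm_projection:
  assumes N: "is_cstar_norm N" and p: "is_projection p" "p \<noteq> 0"
  shows "N p = 1"
proof -
  have "N p = (N p)\<^sup>2" "N p \<noteq> 0"
    using N p unfolding is_cstar_norm_def is_projection_def by metis+
  then show ?thesis by (simp add: power2_eq_square)
qed

lemma abs_le_cstar_norm:
  assumes N: "is_cstar_norm N" and p: "resolution_of_one R p" and r: "r \<in> R"
  shows "cmod (f r) \<le> N (\<Sum>s\<in>R. f s *\<^sub>C p s)"
proof -
  have pr: "N (p r) = 1"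
    using cstar_norm_projection[OF N] p r by (simp add: resolution_of_one_def)
  have "cmod (f r) = N ((\<Sum>s\<in>R. f s *\<^sub>C p s) * p r)"
    using N pr by (simp add: resolution_of_one_component[OF p r] is_cstar_norm_def)
  also have "\<dots> \<le> N (\<Sum>s\<in>R. f s *\<^sub>C p s) * N (p r)"
    using N by (simp add: is_cstar_norm_def)
  finally show ?thesis by (simp add: pr)
qed

lemma cstar_norm_isometry:
  assumes N: "is_cstar_norm N" and u: "star u * u = 1"
  shows "N u = (1::real)"
proof -
  have "N (1::'a) = 1"
    by (rule cstar_norm_projection[OF N]) (simp_all add: is_projection_def)
  then have "(N u)\<^sup>2 = 1" using N u by (metis is_cstar_norm_def)
  then show ?thesis using cstar_norm_nonneg[OF N, of u] by (simp add: power2_eq_1_iff)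
qed

text \<open>With \<open>M = N' h\<close>, all eigenvalues of \<open>h\<close> lie in \<open>[-M, M]\<close>. Hence \<open>h\<close> is \<open>M\<close> times the mean of a unitary
  \<open>u\<close> and its adjoint, where \<open>u\<close> has the eigenvalue \<open>cis (arccos (r / M))\<close> in place of \<open>r\<close>. Every
  C*-norm takes the value \<open>1\<close> at unitaries, whence \<open>N h \<le> M\<close>.\<close>
lemma cstar_norm_selfadjoint_le:
  fixes h :: "'a::fd_cstar_algebra"
  assumes N: "is_cstar_norm N" and N': "is_cstar_norm N'" and h: "star h = h"
  shows "N h \<le> N' h"
proof (cases "h = 0")
  case True
  then show ?thesis using is_cstar_normD(1)[OF N, of h] is_cstar_normD(1)[OF N', of h] by simp
next
  case False
  obtain R p where p: "resolution_of_one R p" and hp: "h = (\<Sum>r\<in>R. complex_of_real r *\<^sub>C p r)"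
    by (rule spectral_decomposition[OF h])
  define M where "M = N' h"
  have "M > 0"
    using False N' cstar_norm_nonneg[OF N', of h] by (simp add: M_def is_cstar_norm_def less_le)
  have bound: "-1 \<le> r / M" "r / M \<le> 1" if "r \<in> R" for r
    using abs_le_cstar_norm[OF N' p that, of complex_of_real] \<open>M > 0\<close>
    by (simp_all add: M_def hp[symmetric] divide_simps abs_le_iff)
  define c where "c r = cis (arccos (r / M))" for r
  define u where "u = (\<Sum>r\<in>R. c r *\<^sub>C p r)"
  have cc: "cnj (c r) * c r = 1" for r
    by (simp add: c_def cis_cnj cis_mult)
  have su: "star u = (\<Sum>r\<in>R. cnj (c r) *\<^sub>C p r)"
    unfolding u_def by (rule resolution_of_one_star[OF p])
  have one: "(\<Sum>r\<in>R. p r) = 1" using p by (simp add: resolution_of_one_def)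
  have "star u * u = 1" "u * star u = 1"
    unfolding su unfolding u_def resolution_of_one_combine[OF p]
    using cc by (simp_all add: one mult.commute)
  then have "N u = 1" "N (star u) = 1"
    by (auto intro: cstar_norm_isometry[OF N] simp: star_star)
  have "complex_of_real (M / 2) * (c r + cnj (c r)) = complex_of_real r" if "r \<in> R" for r
    using bound[OF that] \<open>M > 0\<close>
    by (simp add: complex_add_cnj c_def cos_arccos complex_eq_iff)
  then have "(\<Sum>r\<in>R. complex_of_real r *\<^sub>C p r) =
      (\<Sum>r\<in>R. (complex_of_real (M / 2) * (c r + cnj (c r))) *\<^sub>C p r)"
    by (intro sum.cong refl) simp
  then have "h = complex_of_real (M / 2) *\<^sub>C (u + star u)"
    unfolding hp su unfolding u_def
    by (simp only: scaleC_scaleC[symmetric] scaleC_add_left scaleC_add_right sum.distrib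
        cvec.scale_sum_right)
  then have "N h = M / 2 * N (u + star u)"
    using N \<open>M > 0\<close> by (simp add: is_cstar_norm_def)
  also have "N (u + star u) \<le> N u + N (star u)"
    using N by (simp add: is_cstar_norm_def)
  finally show ?thesis
    using \<open>N u = 1\<close> \<open>N (star u) = 1\<close> \<open>M > 0\<close> by (simp add: M_def)
qed

theorem cstar_norm_unique:
  fixes N :: "'a::fd_cstar_algebra \<Rightarrow> real"
  assumes N: "is_cstar_norm N"
  shows "N x = norm x"
proof -
  have "star (star x * x) = star x * x" by (simp add: star_mult star_star)
  then have "N (star x * x) = norm (star x * x)"
    using cstar_norm_selfadjoint_le N is_cstar_norm_norm by (intro antisym) blast+
  then have "(N x)\<^sup>2 = (norm x)\<^sup>2"
    using N by (simp add: is_cstar_norm_def norm_star_mult)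
  then show ?thesis using cstar_norm_nonneg[OF N, of x] by (simp add: power2_eq_iff_nonneg)
qed

definition mat1 :: "'a \<Rightarrow> 'a mat"
  where "mat1 x = mat 1 1 (\<lambda>_. x)"

lemma mat1_carrier [simp]: "mat1 x \<in> carrier_mat 1 1"
  and mat1_index [simp]: "mat1 x $$ (0, 0) = x"
  by (simp_all add: mat1_def)

lemma mat1_cases:
  assumes "X \<in> carrier_mat 1 1"
  obtains x where "X = mat1 x"
proof
  show "X = mat1 (X $$ (0, 0))"
    using assms by (intro eq_matI) (auto simp: mat1_def)
qed

lemma map_mat_mat1: "map_mat f (mat1 x) = mat1 (f x)"
  and mat1_add: "mat1 (x :: 'b::star_algebra) + mat1 y = mat1 (x + y)"
  and mat1_mult: "mat1 x * mat1 y = mat1 (x * y)"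
  and star_mat1: "star_mat (mat1 x) = mat1 (star x)"
  and mat1_eq_0: "mat1 x = 0\<^sub>m 1 1 \<longleftrightarrow> x = 0"
  by (auto simp: mat1_def star_mat_def mat_eq_iff scalar_prod_def)

lemma is_cstar_norm_mat_1_iff: "is_cstar_norm_mat 1 N \<longleftrightarrow> is_cstar_norm (\<lambda>x. N (mat1 x))"
proof -
  have ball: "(\<forall>X \<in> carrier_mat 1 1. P X) \<longleftrightarrow> (\<forall>x. P (mat1 x))" for P :: "'a mat \<Rightarrow> bool"
    by (metis mat1_carrier mat1_cases)
  show ?thesis
    unfolding is_cstar_norm_mat_def is_cstar_norm_def ball
    by (simp only: map_mat_mat1 mat1_add mat1_mult star_mat1 mat1_eq_0) blast
qed

lemma cstar_norm_mat_1: "cstar_norm_mat 1 (mat1 x) = norm (x :: 'a::fd_cstar_algebra)"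
  unfolding cstar_norm_mat_def
proof (rule the_equality)
  show "\<exists>N. is_cstar_norm_mat 1 N \<and> norm x = N (mat1 x)"
    by (rule exI[of _ "\<lambda>X. norm (X $$ (0, 0))"])
      (simp add: is_cstar_norm_mat_1_iff is_cstar_norm_norm del: One_nat_def)
next
  fix r
  assume "\<exists>N. is_cstar_norm_mat 1 N \<and> r = N (mat1 x)"
  then obtain N :: "'a mat \<Rightarrow> real" where "is_cstar_norm (\<lambda>x. N (mat1 x))" "r = N (mat1 x)"
    by (auto simp only: is_cstar_norm_mat_1_iff)
  then show "r = norm x" using cstar_norm_unique by blast
qed

text \<open>Uniqueness of the C*-norm identifies the norm on one-by-one matrices with the given norm, so that
  the case of one-by-one matrices in complete contractivity is ordinary contractivity.\<close>
lemma completely_contractive_norm_le: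
  fixes \<phi> :: "'a::fd_cstar_algebra \<Rightarrow> 'b::fd_cstar_algebra"
  assumes "completely_contractive \<phi>"
  shows "norm (\<phi> x) \<le> norm x"
proof -
  have "\<forall>X \<in> carrier_mat 1 1. cstar_norm_mat 1 (map_mat \<phi> X) \<le> cstar_norm_mat 1 X"
    using spec[OF assms[unfolded completely_contractive_def], of 1] by simp
  then have "cstar_norm_mat 1 (map_mat \<phi> (mat1 x)) \<le> cstar_norm_mat 1 (mat1 x)"
    by (rule bspec) (rule mat1_carrier)
  then show ?thesis by (simp only: map_mat_mat1 cstar_norm_mat_1)
qed

lemma ex_square_root_one_minus:
  fixes h :: "'a::fd_cstar_algebra"
  assumes h: "star h = h" and le: "norm h \<le> 1"
  shows "\<exists>v. star v * v = 1 - h"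
proof -
  obtain R p where p: "resolution_of_one R p" and hp: "h = (\<Sum>r\<in>R. complex_of_real r *\<^sub>C p r)"
    by (rule spectral_decomposition[OF h])
  have r: "r \<le> 1" if "r \<in> R" for r
    using abs_le_cstar_norm[OF is_cstar_norm_norm p that, of complex_of_real] le
    by (simp add: hp[symmetric])
  define v where "v = (\<Sum>r\<in>R. complex_of_real (sqrt (1 - r)) *\<^sub>C p r)"
  have "star v * v = (\<Sum>r\<in>R. complex_of_real (sqrt (1 - r) * sqrt (1 - r)) *\<^sub>C p r)"
    unfolding v_def resolution_of_one_star[OF p] resolution_of_one_combine[OF p]
    by (simp only: complex_cnj_complex_of_real of_real_mult)
  also have "\<dots> = (\<Sum>r\<in>R. p r - complex_of_real r *\<^sub>C p r)"
    using r by (intro sum.cong refl) (simp add: cvec.scale_left_diff_distrib)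
  also have "\<dots> = 1 - h"
    using p by (simp add: hp sum_subtractf resolution_of_one_def)
  finally show ?thesis by blast
qed

section \<open>Complete positivity and the Schwarz inequality\<close>

lemma star_mat_mult_index:
  assumes "Y \<in> carrier_mat n n" "i < n" "j < n"
  shows "(star_mat Y * Y) $$ (i, j) = (\<Sum>k<n. star (Y $$ (k, i)) * Y $$ (k, j))"
  using assms by (auto simp: star_mat_def scalar_prod_def atLeast0LessThan)

text \<open>The matrix with entries \<open>star (a i) * a j\<close> is \<open>star_mat Y * Y\<close>, where the first row of \<open>Y\<close> is \<open>a\<close> and all
  other rows vanish. Its image is positive, hence again a Gram matrix.\<close>
lemma completely_positive_gram:
  fixes \<phi> :: "'a::star_algebra \<Rightarrow> 'b::star_algebra" and n :: nat
  assumes cp: "completely_positive \<phi>" and \<phi>0: "\<phi> 0 = 0" and n: "n > 0"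
  shows "\<exists>z. \<forall>i<n. \<forall>j<n. \<phi> (star (a i) * a j) = (\<Sum>k<n. star (z k i) * z k j)"
proof -
  define Y where "Y = mat n n (\<lambda>(k, i). if k = 0 then a i else 0)"
  have Y: "Y \<in> carrier_mat n n" by (simp add: Y_def)
  then have "positive_mat n (star_mat Y * Y)" unfolding positive_mat_def by blast
  then have "positive_mat n (map_mat \<phi> (star_mat Y * Y))"
    using cp by (simp add: completely_positive_def)
  then obtain Z where Z: "Z \<in> carrier_mat n n" "map_mat \<phi> (star_mat Y * Y) = star_mat Z * Z"
    unfolding positive_mat_def by blast
  have "\<phi> (star (a i) * a j) = (\<Sum>k<n. star (Z $$ (k, i)) * Z $$ (k, j))" if ij: "i < n" "j < n" for i j
  proof -
    have "(star_mat Y * Y) $$ (i, j) = (\<Sum>k<n. if k = 0 then star (a i) * a j else 0)"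
      unfolding star_mat_mult_index[OF Y ij] using ij by (intro sum.cong) (auto simp: Y_def)
    also have "\<dots> = star (a i) * a j" using n by simp
    finally have "map_mat \<phi> (star_mat Y * Y) $$ (i, j) = \<phi> (star (a i) * a j)"
      using Y ij by (simp add: star_mat_def)
    then show ?thesis unfolding Z(2) star_mat_mult_index[OF Z(1) ij] by simp
  qed
  then show ?thesis by (intro exI[of _ "\<lambda>k i. Z $$ (k, i)"] allI impI)
qed

text \<open>The images of \<open>x = star 1 * x\<close> and of \<open>star x = star x * 1\<close> are opposite off-diagonal entries of a
  two-by-two Gram matrix.\<close>
lemma completely_positive_star:
  fixes \<phi> :: "'a::star_algebra \<Rightarrow> 'b::star_algebra"
  assumes cp: "completely_positive \<phi>" and \<phi>0: "\<phi> 0 = 0"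
  shows "\<phi> (star x) = star (\<phi> x)"
proof -
  define a where "a i = (if i = 0 then 1 else x)" for i :: nat
  obtain z :: "nat \<Rightarrow> nat \<Rightarrow> 'b" where z: "\<forall>i<2. \<forall>j<2. \<phi> (star (a i) * a j) = (\<Sum>k<2::nat. star (z k i) * z k j)"
    using completely_positive_gram[OF cp \<phi>0, of 2 a] by auto
  have "\<phi> (star (a 0) * a 1) = (\<Sum>k<2. star (z k 0) * z k 1)"
    "\<phi> (star (a 1) * a 0) = (\<Sum>k<2. star (z k 1) * z k 0)"
    using z by simp_all
  then show ?thesis by (simp add: a_def star_sum star_mult star_star)
qed

text \<open>The Kadison--Schwarz inequality and its case of equality, seen through the faithful trace. Let the
  columns \<open>z\<^sub>0, z\<^sub>1, z\<^sub>2\<close> realise the image of the Gram matrix of \<open>1, x, a\<close>, and let \<open>1 - \<phi> 1 = star v * v\<close>.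
  Then the defect \<open>D x\<close> is the sum of the squares of the entries of \<open>w = z\<^sub>1 - z\<^sub>0 \<phi>(x)\<close> and of
  the square of \<open>v \<phi>(x)\<close>. If its trace vanishes, then \<open>z\<^sub>1 = z\<^sub>0 \<phi>(x)\<close>, and pairing with \<open>z\<^sub>2\<close> gives
  the multiplicativity relation.\<close>
lemma schwarz_defect:
  fixes \<phi> :: "'a::fd_cstar_algebra \<Rightarrow> 'b::fd_cstar_algebra"
  assumes cp: "completely_positive \<phi>" and \<phi>0: "\<phi> 0 = 0" and le: "norm (\<phi> 1) \<le> 1"
  defines "D \<equiv> \<lambda>x. \<phi> (star x * x) - star (\<phi> x) * \<phi> x"
  shows "Re (reg_trace (D x)) \<ge> 0"
    and "Re (reg_trace (D x)) = 0 \<Longrightarrow> \<phi> (star a * x) = star (\<phi> a) * \<phi> x"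
proof -
  note \<phi>_star = completely_positive_star[OF cp \<phi>0]
  define c where "c i = (if i = 0 then 1 else if i = 1 then x else a)" for i :: nat
  obtain z :: "nat \<Rightarrow> nat \<Rightarrow> 'b" where z: "\<forall>i<3. \<forall>j<3. \<phi> (star (c i) * c j) = (\<Sum>k<3::nat. star (z k i) * z k j)"
    using completely_positive_gram[OF cp \<phi>0, of 3 c] by auto
  have zz: "(\<Sum>k<3::nat. star (z k i) * z k j) = \<phi> (star (c i) * c j)" if "i < 3" "j < 3" for i j
    using z that by simp
  have gram:
    "(\<Sum>k<3. star (z k 0) * z k 0) = \<phi> 1"
    "(\<Sum>k<3. star (z k 0) * z k 1) = \<phi> x"
    "(\<Sum>k<3. star (z k 1) * z k 0) = star (\<phi> x)"
    "(\<Sum>k<3. star (z k 1) * z k 1) = \<phi> (star x * x)"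
    "(\<Sum>k<3. star (z k 2) * z k 0) = star (\<phi> a)"
    "(\<Sum>k<3. star (z k 2) * z k 1) = \<phi> (star a * x)"
    by (simp_all only: zz) (simp_all add: zz c_def \<phi>_star)
  define w where "w k = z k 1 - z k 0 * \<phi> x" for k
  have "star (\<phi> 1) = \<phi> 1" using \<phi>_star[of 1] by simp
  then obtain v where v: "star v * v = 1 - \<phi> 1"
    using ex_square_root_one_minus le by blast
  have "star (w k) * w k = star (z k 1) * z k 1 - (star (z k 1) * z k 0) * \<phi> x
      - star (\<phi> x) * (star (z k 0) * z k 1) + star (\<phi> x) * (star (z k 0) * z k 0) * \<phi> x" for k
    by (simp add: w_def star_diff star_mult algebra_simps)
  then have "(\<Sum>k<3. star (w k) * w k) = \<phi> (star x * x) - star (\<phi> x) * \<phi> x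
      - star (\<phi> x) * \<phi> x + star (\<phi> x) * \<phi> 1 * \<phi> x"
    by (simp only: sum.distrib sum_subtractf sum_distrib_left[symmetric]
        sum_distrib_right[symmetric] gram)
  moreover have "star (v * \<phi> x) * (v * \<phi> x) = star (\<phi> x) * \<phi> x - star (\<phi> x) * \<phi> 1 * \<phi> x"
  proof -
    have "star (v * \<phi> x) * (v * \<phi> x) = star (\<phi> x) * (star v * v) * \<phi> x"
      by (simp add: star_mult mult.assoc)
    then show ?thesis by (simp add: v algebra_simps)
  qed
  ultimately have D: "D x = (\<Sum>k<3. star (w k) * w k) + star (v * \<phi> x) * (v * \<phi> x)"
    by (simp add: D_def)
  have trD: "Re (reg_trace (D x)) =
      (\<Sum>k<3. Re (reg_trace (star (w k) * w k))) + Re (reg_trace (star (v * \<phi> x) * (v * \<phi> x)))"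
    by (simp only: D reg_trace_add reg_trace_sum Re_sum plus_complex.simps)
  show "Re (reg_trace (D x)) \<ge> 0"
    unfolding trD by (intro add_nonneg_nonneg sum_nonneg Re_reg_trace_nonneg)
  assume "Re (reg_trace (D x)) = 0"
  then have "(\<Sum>k<3. Re (reg_trace (star (w k) * w k))) = 0"
    unfolding trD using Re_reg_trace_nonneg
    by (subst (asm) add_nonneg_eq_0_iff) (auto intro: sum_nonneg)
  then have "\<forall>k\<in>{..<3}. Re (reg_trace (star (w k) * w k)) = 0"
    by (subst (asm) sum_nonneg_eq_0_iff) (auto intro: Re_reg_trace_nonneg)
  then have "z k 1 = z k 0 * \<phi> x" if "k < 3" for k
    using Re_reg_trace_eq_0[of "w k"] that by (simp add: w_def)
  then have "(\<Sum>k<3. star (z k 2) * z k 1) = (\<Sum>k<3. star (z k 2) * z k 0) * \<phi> x"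
    unfolding sum_distrib_right by (intro sum.cong) (simp_all add: mult.assoc)
  then show "\<phi> (star a * x) = star (\<phi> a) * \<phi> x" by (simp only: gram)
qed

section \<open>Slices and images of projections in the tensor product\<close>

text \<open>The slice map \<open>id \<otimes> reg_trace\<close>\<close>
definition trace_slice :: "('b::complex_vector, 'a::fd_cstar_algebra opposite) tensor \<Rightarrow> 'b"
  where "trace_slice = tensor_lift scaleC (\<lambda>x y. reg_trace (unop y) *\<^sub>C x)"

lemma bilinear_trace_slice:
  "bilinear_by scaleC (\<lambda>(x::'b::complex_vector) (y::'a::fd_cstar_algebra opposite). reg_trace (unop y) *\<^sub>C x)"
  by (simp add: bilinear_by_def plus_opposite.rep_eq scaleC_opposite.rep_eq reg_trace_add
      reg_trace_scaleC scaleC_add_left scaleC_add_right scaleC_scaleC mult.commute)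

lemma trace_slice_pure: "trace_slice (x \<otimes>\<^sub>t Op y) = reg_trace y *\<^sub>C x"
  by (simp add: trace_slice_def tensor_lift_pure[OF vector_space_scaleC bilinear_trace_slice] Op_inverse)

lemma trace_slice_sum: "trace_slice (\<Sum>i\<in>I. f i) = (\<Sum>i\<in>I. trace_slice (f i))"
  by (induction I rule: infinite_finite_induct)
    (simp_all add: trace_slice_def tensor_lift_add[OF vector_space_scaleC bilinear_trace_slice]
      tensor_lift_0[OF vector_space_scaleC bilinear_trace_slice])

lemma tensor_map_zero:
  assumes "clinear \<phi>" "clinear \<psi>"
  shows "tensor_map \<phi> \<psi> 0 = 0"
  using tensor_map_add[OF assms, of 0 0] by simp

lemma tensor_map_sum:
  assumes "clinear \<phi>" "clinear \<psi>"
  shows "tensor_map \<phi> \<psi> (\<Sum>i\<in>I. f i) = (\<Sum>i\<in>I. tensor_map \<phi> \<psi> (f i))"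
  by (induction I rule: infinite_finite_induct)
    (simp_all add: tensor_map_zero[OF assms] tensor_map_add[OF assms])

lemma is_projection_tensor_map:
  assumes \<phi>: "star_homomorphism \<phi>" and \<psi>: "star_homomorphism \<psi>" and p: "is_projection p"
  shows "is_projection (tensor_map \<phi> \<psi> p)"
proof -
  have lin: "clinear \<phi>" "clinear \<psi>" using \<phi> \<psi> by (simp_all add: star_homomorphism_def)
  note simps = tensor_map_add[OF lin] tensor_map_zero[OF lin] tensor_map_pure[OF lin]
  have "tensor_map \<phi> \<psi> (x * y) = tensor_map \<phi> \<psi> x * tensor_map \<phi> \<psi> y" for x y
  proof (induction x rule: tensor_induct)
    case (pure a b)
    show ?case
      by (induction y rule: tensor_induct)
        (use \<phi> \<psi> in \<open>simp_all add: simps tensor_mult_pure star_homomorphism_def distrib_left\<close>)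
  qed (simp_all add: simps distrib_right)
  moreover have "tensor_map \<phi> \<psi> (star x) = star (tensor_map \<phi> \<psi> x)" for x
    by (induction x rule: tensor_induct)
      (use \<phi> \<psi> in \<open>simp_all add: simps tensor_star_pure star_add star_homomorphism_def\<close>)
  ultimately show ?thesis using p by (metis is_projection_def)
qed

text \<open>Let \<open>P\<close> be the image of the Casimir element \<open>d\<close>. Since \<open>d = star d * d\<close> and \<open>P = star P * P\<close>, the
  sums of \<open>\<phi> (star b * c) \<otimes> Op (star c * b)\<close> and of \<open>(star (\<phi> b) * \<phi> c) \<otimes> Op (star c * b)\<close> over all
  pairs \<open>b\<close>, \<open>c\<close> agree. Slicing with the trace retains only the terms with \<open>b = c\<close>, by orthonormality.\<close>
theorem schwarz_defects_sum_to_zero: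
  fixes \<phi> :: "'a::fd_cstar_algebra \<Rightarrow> 'b::star_algebra"
  assumes S: "orthonormal_basis S" and \<phi>: "clinear \<phi>"
    and proj: "is_projection (tensor_map \<phi> id (casimir S))"
  shows "(\<Sum>b\<in>S. \<phi> (star b * b) - star (\<phi> b) * \<phi> b) = 0"
proof -
  note lin = \<phi> clinear_id
  have slice: "trace_slice (\<Sum>b\<in>S. \<Sum>c\<in>S. f b c \<otimes>\<^sub>t Op (star c * b)) = (\<Sum>b\<in>S. f b b)"
    for f :: "'a \<Rightarrow> 'a \<Rightarrow> 'b"
  proof -
    have "trace_slice (\<Sum>b\<in>S. \<Sum>c\<in>S. f b c \<otimes>\<^sub>t Op (star c * b)) =
        (\<Sum>b\<in>S. \<Sum>c\<in>S. if c = b then f b c else 0)"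
      unfolding trace_slice_sum trace_slice_pure
      using S by (intro sum.cong refl) (auto simp: orthonormal_basis_def orthonormal_def)
    then show ?thesis using S by (simp add: orthonormal_basis_def)
  qed
  let ?P = "tensor_map \<phi> id (casimir S)"
  have P: "?P = (\<Sum>b\<in>S. \<phi> b \<otimes>\<^sub>t Op (star b))"
    by (simp add: casimir_def tensor_map_sum[OF lin] tensor_map_pure[OF lin])
  have "casimir S = star (casimir S) * casimir S"
    using casimir_projection[OF S] by (simp add: is_projection_def)
  also have "\<dots> = (\<Sum>b\<in>S. \<Sum>c\<in>S. (star b * c) \<otimes>\<^sub>t Op (star c * b))"
    by (simp add: casimir_def star_sum sum_product tensor_star_pure tensor_mult_pure Op_star
        Op_mult star_star)
  finally have "?P = (\<Sum>b\<in>S. \<Sum>c\<in>S. \<phi> (star b * c) \<otimes>\<^sub>t Op (star c * b))"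
    by (simp add: tensor_map_sum[OF lin] tensor_map_pure[OF lin])
  moreover have "?P = (\<Sum>b\<in>S. \<Sum>c\<in>S. (star (\<phi> b) * \<phi> c) \<otimes>\<^sub>t Op (star c * b))"
  proof -
    have "?P = star ?P * ?P" using proj by (simp add: is_projection_def)
    then show ?thesis
      by (simp add: P star_sum sum_product tensor_star_pure tensor_mult_pure Op_star
          Op_mult star_star)
  qed
  ultimately have "trace_slice (\<Sum>b\<in>S. \<Sum>c\<in>S. \<phi> (star b * c) \<otimes>\<^sub>t Op (star c * b)) =
      trace_slice (\<Sum>b\<in>S. \<Sum>c\<in>S. (star (\<phi> b) * \<phi> c) \<otimes>\<^sub>t Op (star c * b))"
    by simp
  then show ?thesis unfolding slice by (simp add: sum_subtractf)
qed

section \<open>Homomorphisms and the diagonal projection\<close>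

theorem corollary3p6:
  fixes \<phi> :: "'a::fd_cstar_algebra \<Rightarrow> 'b::fd_cstar_algebra"
    and \<delta> :: "('a, 'a opposite) tensor"
  assumes "clinear \<phi>"
    and "completely_positive \<phi>"
    and "completely_contractive \<phi>"
    and "is_diagonal_projection \<delta>"
  shows "star_homomorphism \<phi> \<longleftrightarrow> is_projection (tensor_map \<phi> id \<delta>)"
proof
  assume "star_homomorphism \<phi>"
  moreover have "star_homomorphism (id :: 'a opposite \<Rightarrow> 'a opposite)"
    by (simp add: star_homomorphism_def clinear_id)
  moreover have "is_projection \<delta>" using assms(4) by (simp add: is_diagonal_projection_def)
  ultimately show "is_projection (tensor_map \<phi> id \<delta>)" by (rule is_projection_tensor_map)
next
  assume proj: "is_projection (tensor_map \<phi> id \<delta>)"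
  obtain S :: "'a set" where S: "orthonormal_basis S" by (rule ex_orthonormal_basis)
  interpret \<phi>: Vector_Spaces.linear scaleC scaleC \<phi> by (rule assms(1))
  have le: "norm (\<phi> 1) \<le> 1"
    using completely_contractive_norm_le[OF assms(3), of 1] by simp
  note \<phi>_star = completely_positive_star[OF assms(2) \<phi>.zero]
  note schwarz = schwarz_defect[OF assms(2) \<phi>.zero le]
  have "(\<Sum>b\<in>S. \<phi> (star b * b) - star (\<phi> b) * \<phi> b) = 0"
    using schwarz_defects_sum_to_zero[OF S assms(1)] proj
    by (simp add: diagonal_projection_eq_casimir[OF assms(4) S])
  then have "(\<Sum>b\<in>S. Re (reg_trace (\<phi> (star b * b) - star (\<phi> b) * \<phi> b))) = 0"
    by (simp only: Re_sum[symmetric] reg_trace_sum[symmetric]) simp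
  then have "\<forall>b\<in>S. Re (reg_trace (\<phi> (star b * b) - star (\<phi> b) * \<phi> b)) = 0"
    using S by (subst (asm) sum_nonneg_eq_0_iff) (auto simp: orthonormal_basis_def schwarz(1))
  then have on_basis: "\<phi> (star a * b) = star (\<phi> a) * \<phi> b" if "b \<in> S" for a b
    using schwarz(2) that by blast
  have "\<phi> (x * y) = \<phi> x * \<phi> y" for x y
  proof -
    define c where "c b = reg_trace (star b * y)" for b
    have y: "y = (\<Sum>b\<in>S. c b *\<^sub>C b)" unfolding c_def by (rule basis_expand[OF S])
    have "\<phi> (x * b) = \<phi> x * \<phi> b" if "b \<in> S" for b
      using on_basis[OF that, of "star x"] by (simp add: \<phi>_star star_star)
    then show ?thesis
      by (simp add: y sum_distrib_left mult_scaleC_right \<phi>.sum \<phi>.scale)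
  qed
  then show "star_homomorphism \<phi>"
    using assms(1) \<phi>_star by (simp add: star_homomorphism_def)
qed

end
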